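(* Suppose $\beta$ lies in the low temperature phase. Then there is a constant $a>0$ such that for all sufficiently large $n$ the mixing time of the Glauber dynamics for $p_n$ is at least $e^{an}$. Moreover the same conclusion holds for any local Markov chain on $\mathcal G_n$ with stationary distribution $p_n$, i.e. any such chain for which every transition changes at most $f(n)$ edges, where $f(n)=o(n)$.
   Context: Fix an integer $s\ge 1$, and graphs $G_1,\dots,G_s$, where $G_i$ has vertex set $V_i=\{1,\dots,|V_i|\}$ and edge set $E_i$; $G_1$ is the graph with vertex set $\{1,2\}$ and the single edge $\{1,2\}$. Fix $\beta=(\beta_1,\dots,\beta_s)$ with $\beta_1\in\mathbb R$ and $\beta_i>0$ for $i\ge 2$. Let $\mathcal G_n$ be the set of simple graphs on vertex set $[n]$, identified with $\{0,1\}^{\binom{[n]}{2}}$. For a fixed graph $G=(V,E)$ with $V=\{1,\dots,m\}$ and $X\in\mathcal G_n$, let $N_G(X)$ be the number of injective maps $\sigma:V\to[n]$ such that $\{\sigma(i),\sigma(j)\}\in X$ for every $\{i,j\}\in E$. The Gibbs measure is $p_n(X)=Z_n^{-1}\exp(H(X))$ with $H(X)=\sum_{i=1}^s\beta_i N_{G_i}(X)/n^{|V_i|-2}$. For $X\in\mathcal G_n$ and a pair $e$, $X_{e+}=X\cup\{e\}$, $X_{e-}=X\setminus\{e\}$, $\partial_eH(X)=H(X_{e+})-H(X_{e-})$. The Glauber dynamics, from state $X$, picks $e$ uniformly among the $\binom n2$ pairs and moves to $X_{e+}$ with probability $e^{\partial_eH(X)}/(1+e^{\partial_eH(X)})$ and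 to $X_{e-}$ otherwise. The mixing time is the least $t$ such that from every starting state the law at time $t$ is within total variation distance $e^{-1}$ of stationarity. Define $\Psi(p)=\sum_{i=1}^s 2\beta_i|E_i|p^{|E_i|-1}$ and $\varphi(p)=e^{\Psi(p)}/(1+e^{\Psi(p)})$ on $[0,1]$. $\beta$ is in the low temperature phase if the equation $\varphi(p)=p$ has at least two solutions $p\in[0,1]$ with $\varphi'(p)<1$. *)

theory Defs
  imports "HOL-Analysis.Analysis" "HOL-Library.FuncSet" "HOL-Library.Landau_Symbols"
begin

definition pairs :: "nat \<Rightarrow> nat set set" where
  "pairs n = {{i, j} | i j. i \<in> {1..n} \<and> j \<in> {1..n} \<and> i \<noteq> j}"

definition graphs :: "nat \<Rightarrow> nat set set set" where
  "graphs n = Pow (pairs n)"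

definition simple_graph :: "nat \<Rightarrow> nat set set \<Rightarrow> bool" where
  "simple_graph m E \<longleftrightarrow> E \<subseteq> pairs m"

definition hom_count :: "nat \<Rightarrow> nat set set \<Rightarrow> nat \<Rightarrow> nat set set \<Rightarrow> nat" where
  "hom_count m E n X = card {\<sigma> \<in> {1..m} \<rightarrow>\<^sub>E {1..n}. inj_on \<sigma> {1..m} \<and> (\<forall>e\<in>E. \<sigma> ` e \<in> X)}"

definition hamiltonian ::
  "nat \<Rightarrow> (nat \<Rightarrow> nat) \<Rightarrow> (nat \<Rightarrow> nat set set) \<Rightarrow> (nat \<Rightarrow> real) \<Rightarrow> nat \<Rightarrow> nat set set \<Rightarrow> real" where
  "hamiltonian s m E \<beta> n X =
     (\<Sum>i=1..s. \<beta> i * real (hom_count (m i) (E i) n X) / (real n powi (int (m i) - 2)))"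

definition gibbs ::
  "nat \<Rightarrow> (nat \<Rightarrow> nat) \<Rightarrow> (nat \<Rightarrow> nat set set) \<Rightarrow> (nat \<Rightarrow> real) \<Rightarrow> nat \<Rightarrow> nat set set \<Rightarrow> real" where
  "gibbs s m E \<beta> n X =
     exp (hamiltonian s m E \<beta> n X) / (\<Sum>Y\<in>graphs n. exp (hamiltonian s m E \<beta> n Y))"

definition glauber ::
  "nat \<Rightarrow> (nat \<Rightarrow> nat) \<Rightarrow> (nat \<Rightarrow> nat set set) \<Rightarrow> (nat \<Rightarrow> real) \<Rightarrow> nat \<Rightarrow> nat set set \<Rightarrow> nat set set \<Rightarrow> real" where
  "glauber s m E \<beta> n X Y =
     (\<Sum>e\<in>pairs n.
        let d = hamiltonian s m E \<beta> n (insert e X) - hamiltonian s m E \<beta> n (X - {e});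
            q = exp d / (1 + exp d)
        in (if Y = insert e X then q else 0) + (if Y = X - {e} then 1 - q else 0))
     / real (n choose 2)"

fun kpow :: "'a set \<Rightarrow> ('a \<Rightarrow> 'a \<Rightarrow> real) \<Rightarrow> nat \<Rightarrow> 'a \<Rightarrow> 'a \<Rightarrow> real" where
  "kpow S P 0 x y = (if x = y then 1 else 0)"
| "kpow S P (Suc t) x y = (\<Sum>z\<in>S. kpow S P t x z * P z y)"

definition tv_dist :: "'a set \<Rightarrow> ('a \<Rightarrow> real) \<Rightarrow> ('a \<Rightarrow> real) \<Rightarrow> real" where
  "tv_dist S \<mu> \<nu> = (\<Sum>y\<in>S. \<bar>\<mu> y - \<nu> y\<bar>) / 2"

text \<open>Mixing time (infinite if the chain never gets within e^-1 of pi from all starts).\<close>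
definition mixing_time :: "'a set \<Rightarrow> ('a \<Rightarrow> 'a \<Rightarrow> real) \<Rightarrow> ('a \<Rightarrow> real) \<Rightarrow> enat" where
  "mixing_time S P \<pi> =
     (INF t\<in>{t. \<forall>x\<in>S. tv_dist S (kpow S P t x) \<pi> \<le> exp (-1)}. enat t)"

definition markov_kernel :: "'a set \<Rightarrow> ('a \<Rightarrow> 'a \<Rightarrow> real) \<Rightarrow> bool" where
  "markov_kernel S P \<longleftrightarrow> (\<forall>x\<in>S. \<forall>y\<in>S. 0 \<le> P x y) \<and> (\<forall>x\<in>S. (\<Sum>y\<in>S. P x y) = 1)"

definition stationary :: "'a set \<Rightarrow> ('a \<Rightarrow> 'a \<Rightarrow> real) \<Rightarrow> ('a \<Rightarrow> real) \<Rightarrow> bool" where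
  "stationary S P \<pi> \<longleftrightarrow> (\<forall>y\<in>S. (\<Sum>x\<in>S. \<pi> x * P x y) = \<pi> y)"

definition local_chain :: "nat set set set \<Rightarrow> (nat set set \<Rightarrow> nat set set \<Rightarrow> real) \<Rightarrow> real \<Rightarrow> bool" where
  "local_chain S P k \<longleftrightarrow>
     (\<forall>X\<in>S. \<forall>Y\<in>S. P X Y > 0 \<longrightarrow> real (card ((X - Y) \<union> (Y - X))) \<le> k)"

definition Psi :: "nat \<Rightarrow> (nat \<Rightarrow> nat set set) \<Rightarrow> (nat \<Rightarrow> real) \<Rightarrow> real \<Rightarrow> real" where
  "Psi s E \<beta> p = (\<Sum>i=1..s. 2 * \<beta> i * real (card (E i)) * p powi (int (card (E i)) - 1))"

definition phi :: "nat \<Rightarrow> (nat \<Rightarrow> nat set set) \<Rightarrow> (nat \<Rightarrow> real) \<Rightarrow> real \<Rightarrow> real" where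
  "phi s E \<beta> p = exp (Psi s E \<beta> p) / (1 + exp (Psi s E \<beta> p))"

definition low_temperature :: "nat \<Rightarrow> (nat \<Rightarrow> nat set set) \<Rightarrow> (nat \<Rightarrow> real) \<Rightarrow> bool" where
  "low_temperature s E \<beta> \<longleftrightarrow>
     (\<exists>p q. p \<in> {0..1} \<and> q \<in> {0..1} \<and> p \<noteq> q \<and>
        phi s E \<beta> p = p \<and> phi s E \<beta> q = q \<and>
        deriv (phi s E \<beta>) p < 1 \<and> deriv (phi s E \<beta>) q < 1)"

end

theory Submission
  imports Defs
begin

text \<open>
  Write \<open>D\<^sub>e(X) = H(X \<union> {e}) - H(X - {e})\<close>. It is increasing in \<open>X\<close>, because only \<open>\<beta>\<^sub>1\<close> may be
  negative and the edge term contributes a constant. Stability of two fixed points gives \<open>u < v\<close>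
  with \<open>\<phi>(u) < u\<close> and \<open>v < \<phi>(v)\<close>. Consider the disjoint wells
  \<open>A = {X. \<forall>e. D\<^sub>e(X) \<le> \<Psi>(u)}\<close> and \<open>B = {X. \<forall>e. D\<^sub>e(X) \<ge> \<Psi>(v)}\<close>, one of which has mass at
  most \<open>1/2\<close>.

  The Gibbs measure conditioned on the decreasing set \<open>A\<close> has all conditional edge probabilities
  at most \<open>\<phi>(u)\<close>, so it is stochastically dominated by the Erdos-Renyi measure of density
  \<open>\<phi>(u)\<close>. Under the latter \<open>D\<^sub>e\<close> has mean close to \<open>\<Psi>(\<phi>(u)) < \<Psi>(u)\<close>; the influences of the
  single edges on \<open>D\<^sub>e\<close> are \<open>O(1/n)\<close> and sum to \<open>O(1)\<close>, so their squares sum to \<open>O(1/n)\<close> and bounded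
  differences give exponential concentration. Hence the part of \<open>A\<close> from which \<open>o(n)\<close> edge changes can leave \<open>A\<close>
  has conditional mass \<open>e\<close> to the power \<open>-\<Omega>(n)\<close>. The well \<open>B\<close> is treated by passing to complements, and
  a bottleneck argument bounds the mixing time.
\<close>

subsection \<open>Bernoulli product measures\<close>

text \<open>Expectation over the random subset of \<open>P\<close> that contains each element
  independently with probability \<open>\<rho>\<close>. As a finite sum it lets elements be split
  off one at a time, which drives the inductions below.\<close>

definition bernoulli_mean :: "real \<Rightarrow> 'a set \<Rightarrow> ('a set \<Rightarrow> real) \<Rightarrow> real" where
  "bernoulli_mean \<rho> P f = (\<Sum>X\<in>Pow P. \<rho> ^ card X * (1 - \<rho>) ^ card (P - X) * f X)"

lemma sum_Pow_insert:
  fixes f :: "'a set \<Rightarrow> 'b::comm_monoid_add"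
  assumes "finite P" "e \<notin> P"
  shows "(\<Sum>X\<in>Pow (insert e P). f X) = (\<Sum>X\<in>Pow P. f X + f (insert e X))"
proof -
  have inj: "inj_on (insert e) (Pow P)"
    using assms(2) by (auto simp: inj_on_def)
  have "(\<Sum>X\<in>Pow (insert e P). f X) = (\<Sum>X\<in>Pow P. f X) + (\<Sum>X\<in>insert e ` Pow P. f X)"
    unfolding Pow_insert using assms by (intro sum.union_disjoint) auto
  then show ?thesis
    by (simp add: sum.reindex[OF inj] sum.distrib)
qed

lemma bernoulli_mean_insert:
  assumes "finite P" "e \<notin> P"
  shows "bernoulli_mean \<rho> (insert e P) f
    = bernoulli_mean \<rho> P (\<lambda>X. (1 - \<rho>) * f X + \<rho> * f (insert e X))"
  unfolding bernoulli_mean_def sum_Pow_insert[OF assms]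
proof (rule sum.cong[OF refl])
  fix X assume "X \<in> Pow P"
  then have X: "finite X" "e \<notin> X" "insert e P - X = insert e (P - X)" "insert e P - insert e X = P - X"
    using assms finite_subset by auto
  have "card (insert e P - X) = Suc (card (P - X))"
    unfolding X(3) using assms by (intro card_insert_disjoint) auto
  then show "\<rho> ^ card X * (1 - \<rho>) ^ card (insert e P - X) * f X +
      \<rho> ^ card (insert e X) * (1 - \<rho>) ^ card (insert e P - insert e X) * f (insert e X) =
      \<rho> ^ card X * (1 - \<rho>) ^ card (P - X) * ((1 - \<rho>) * f X + \<rho> * f (insert e X))"
    using X(1,2) unfolding X(4) by (simp add: algebra_simps)
qed

lemma bernoulli_mean_mono:
  assumes "0 \<le> \<rho>" "\<rho> \<le> 1" "\<And>X. X \<subseteq> P \<Longrightarrow> f X \<le> g X"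
  shows "bernoulli_mean \<rho> P f \<le> bernoulli_mean \<rho> P g"
  unfolding bernoulli_mean_def using assms by (intro sum_mono mult_left_mono) auto

lemma bernoulli_mean_cmult: "bernoulli_mean \<rho> P (\<lambda>X. c * f X) = c * bernoulli_mean \<rho> P f"
  unfolding bernoulli_mean_def by (simp add: sum_distrib_left mult_ac)

lemma bernoulli_mean_sum:
  "bernoulli_mean \<rho> P (\<lambda>X. \<Sum>i\<in>I. f i X) = (\<Sum>i\<in>I. bernoulli_mean \<rho> P (f i))"
  unfolding bernoulli_mean_def by (simp add: sum_distrib_left sum.swap[of _ _ I])

text \<open>By independence each element of \<open>S\<close> contributes a factor
  \<open>\<rho>\<close> and every other element averages out. Counts of copies of a graph are sums
  of such indicators, so this yields their means.\<close>

lemma bernoulli_mean_superset: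
  assumes "finite P" "S \<subseteq> P"
  shows "bernoulli_mean \<rho> P (\<lambda>X. if S \<subseteq> X then 1 else 0) = \<rho> ^ card S"
  using assms
proof (induction P arbitrary: S rule: finite_induct)
  case empty
  then show ?case by (simp add: bernoulli_mean_def)
next
  case (insert e P)
  have fin: "finite S"
    using insert finite_subset by blast
  show ?case
  proof (cases "e \<in> S")
    case True
    have "bernoulli_mean \<rho> (insert e P) (\<lambda>X. if S \<subseteq> X then 1 else 0)
       = bernoulli_mean \<rho> P (\<lambda>X. \<rho> * (if S - {e} \<subseteq> X then 1 else 0))"
      unfolding bernoulli_mean_insert[OF insert.hyps] unfolding bernoulli_mean_def
      by (rule sum.cong) (use True insert.hyps in auto)
    also have "\<dots> = \<rho> * \<rho> ^ card (S - {e})"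
      using insert by (subst bernoulli_mean_cmult, subst insert.IH) auto
    also have "\<dots> = \<rho> ^ card S"
      using card_Suc_Diff1[OF fin True] by (metis power_Suc)
    finally show ?thesis .
  next
    case False
    have "bernoulli_mean \<rho> (insert e P) (\<lambda>X. if S \<subseteq> X then 1 else 0)
       = bernoulli_mean \<rho> P (\<lambda>X. if S \<subseteq> X then 1 else 0)"
      unfolding bernoulli_mean_insert[OF insert.hyps] unfolding bernoulli_mean_def
      by (rule sum.cong) (use False insert.hyps in auto)
    then show ?thesis
      using insert False by (simp add: subset_insert)
  qed
qed

lemma bernoulli_mean_const:
  assumes "finite P"
  shows "bernoulli_mean \<rho> P (\<lambda>X. c) = c"
  using bernoulli_mean_cmult[of \<rho> P c "\<lambda>X. if {} \<subseteq> X then 1 else 0"]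
    bernoulli_mean_superset[OF assms, of "{}" \<rho>] by simp

lemma sum_Pow_complement:
  fixes f :: "'a set \<Rightarrow> 'b::comm_monoid_add"
  shows "(\<Sum>X\<in>Pow P. f (P - X)) = (\<Sum>X\<in>Pow P. f X)"
  by (rule sum.reindex_bij_witness[of _ "\<lambda>X. P - X" "\<lambda>X. P - X"]) auto

text \<open>The complement of a random set of density \<open>\<rho>\<close> has density
  \<open>1 - \<rho>\<close>. This carries estimates for lower wells over to upper wells.\<close>

lemma bernoulli_mean_complement:
  "bernoulli_mean (1 - \<rho>) P (\<lambda>X. f (P - X)) = bernoulli_mean \<rho> P f"
  unfolding bernoulli_mean_def
  by (subst (2) sum_Pow_complement[symmetric], rule sum.cong) (auto simp: double_diff)

text \<open>If the conditional probability of each element, given all the others, is at most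
  \<open>\<rho>\<close>, then \<open>\<mu>\<close> is stochastically dominated by the product measure; summing out
  one element preserves the hypothesis.\<close>

lemma sum_le_bernoulli_mean:
  fixes \<mu> f :: "'a set \<Rightarrow> real"
  assumes "finite P"
    and "0 \<le> \<rho>" "\<rho> \<le> 1"
    and "\<And>X. X \<subseteq> P \<Longrightarrow> 0 \<le> \<mu> X"
    and "\<And>e X. \<lbrakk>e \<in> P; X \<subseteq> P; e \<notin> X\<rbrakk> \<Longrightarrow> (1 - \<rho>) * \<mu> (insert e X) \<le> \<rho> * \<mu> X"
    and "\<And>e X. \<lbrakk>e \<in> P; X \<subseteq> P; e \<notin> X\<rbrakk> \<Longrightarrow> f X \<le> f (insert e X)"
  shows "(\<Sum>X\<in>Pow P. \<mu> X * f X) \<le> (\<Sum>X\<in>Pow P. \<mu> X) * bernoulli_mean \<rho> P f"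
  using assms
proof (induction P arbitrary: \<mu> f rule: finite_induct)
  case empty
  then show ?case by (simp add: bernoulli_mean_def)
next
  case (insert e P)
  \<comment> \<open>\<open>\<nu>\<close> is the marginal of \<open>\<mu>\<close> on subsets of
    \<open>P\<close>, and \<open>g\<close> averages \<open>f\<close> over the state of
    \<open>e\<close> at density \<open>\<rho>\<close>.\<close>
  define \<nu> where "\<nu> X = \<mu> X + \<mu> (insert e X)" for X
  define g where "g X = (1 - \<rho>) * f X + \<rho> * f (insert e X)" for X
  have "(\<Sum>X\<in>Pow (insert e P). \<mu> X * f X)
      = (\<Sum>X\<in>Pow P. \<mu> X * f X + \<mu> (insert e X) * f (insert e X))"
    using insert.hyps by (rule sum_Pow_insert)
  also have "\<dots> \<le> (\<Sum>X\<in>Pow P. \<nu> X * g X)"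
  proof (rule sum_mono)
    fix X assume "X \<in> Pow P"
    then have X: "X \<subseteq> insert e P" "e \<notin> X" using insert.hyps by auto
    \<comment> \<open>The first factor is nonnegative by the conditional bound at \<open>e\<close>,
      the second because \<open>f\<close> is increasing. Their product is exactly the gain from
      giving \<open>e\<close> density \<open>\<rho>\<close> instead of its conditional law under
      \<open>\<mu>\<close>.\<close>
    have "0 \<le> (\<rho> * \<mu> X - (1 - \<rho>) * \<mu> (insert e X)) * (f (insert e X) - f X)"
      using insert.prems(4)[of e X] insert.prems(5)[of e X] X by simp
    also have "\<dots> = \<nu> X * g X - (\<mu> X * f X + \<mu> (insert e X) * f (insert e X))"
      by (simp add: \<nu>_def g_def algebra_simps)
    finally show "\<mu> X * f X + \<mu> (insert e X) * f (insert e X) \<le> \<nu> X * g X" by simp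
  qed
  also have "\<dots> \<le> (\<Sum>X\<in>Pow P. \<nu> X) * bernoulli_mean \<rho> P g"
  proof (rule insert.IH)
    show "0 \<le> \<nu> X" if "X \<subseteq> P" for X
      unfolding \<nu>_def using that by (intro add_nonneg_nonneg insert.prems) auto
    show "(1 - \<rho>) * \<nu> (insert a X) \<le> \<rho> * \<nu> X" if "a \<in> P" "X \<subseteq> P" "a \<notin> X" for a X
    proof -
      have "a \<noteq> e" using that insert.hyps by auto
      then have "(1 - \<rho>) * \<mu> (insert a (insert e X)) \<le> \<rho> * \<mu> (insert e X)"
        using that by (intro insert.prems) auto
      moreover have "(1 - \<rho>) * \<mu> (insert a X) \<le> \<rho> * \<mu> X"
        using that by (intro insert.prems) auto
      ultimately show ?thesis
        by (simp add: \<nu>_def insert_commute[of e a] algebra_simps)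
    qed
    show "g X \<le> g (insert a X)" if "a \<in> P" "X \<subseteq> P" "a \<notin> X" for a X
    proof -
      have "a \<noteq> e" using that insert.hyps by auto
      then have "f (insert e X) \<le> f (insert a (insert e X))"
        using that by (intro insert.prems) auto
      moreover have "f X \<le> f (insert a X)"
        using that by (intro insert.prems) auto
      ultimately show ?thesis
        unfolding g_def insert_commute[of e a] using insert.prems(1,2)
        by (intro add_mono mult_left_mono) auto
    qed
  qed (use insert.prems in auto)
  also have "\<dots> = (\<Sum>X\<in>Pow (insert e P). \<mu> X) * bernoulli_mean \<rho> (insert e P) f"
    by (simp only: bernoulli_mean_insert[OF insert.hyps] sum_Pow_insert[OF insert.hyps] \<nu>_def g_def[abs_def])
  finally show ?case .
qed

section \<open>Exponential moments under bounded differences\<close>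

lemma exp_le_quadratic:
  fixes x :: real
  assumes "\<bar>x\<bar> \<le> 1"
  shows "exp x \<le> 1 + x + x\<^sup>2"
proof (cases "0 \<le> x")
  case True
  then show ?thesis using assms exp_bound by auto
next
  case False
  define y where "y = - x"
  have y: "0 \<le> y" using False by (simp add: y_def)
  \<comment> \<open>For negative \<open>x\<close> the claim amounts to
    \<open>1 \<le> exp y * (1 - y + y\<^sup>2)\<close>. The quadratic Taylor polynomial of
    \<open>exp y\<close> already suffices, since its product with the last factor exceeds 1 by
    nonnegative powers of \<open>y\<close> only.\<close>
  have "1 \<le> (1 + y + y\<^sup>2 / 2) * (1 - y + y\<^sup>2)"
  proof -
    have "(1 + y + y\<^sup>2 / 2) * (1 - y + y\<^sup>2) = 1 + (y\<^sup>2 + y ^ 3 + y ^ 4) / 2"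
      by (simp add: field_simps power2_eq_square power3_eq_cube power4_eq_xxxx)
    then show ?thesis using y by simp
  qed
  also have "\<dots> \<le> exp y * (1 - y + y\<^sup>2)"
  proof (rule mult_right_mono)
    show "1 + y + y\<^sup>2 / 2 \<le> exp y" using y exp_lower_Taylor_quadratic by auto
    show "0 \<le> 1 - y + y\<^sup>2" using assms by (simp add: y_def add_nonneg_nonneg)
  qed
  finally have "exp (- y) * 1 \<le> exp (- y) * (exp y * (1 - y + y\<^sup>2))"
    by (intro mult_left_mono) auto
  then show ?thesis by (simp add: y_def mult.assoc[symmetric] flip: exp_add)
qed

text \<open>Centring at the mean cancels the linear terms of the quadratic bound for
  \<open>exp\<close> and leaves the variance \<open>\<rho> * (1 - \<rho>) * d\<^sup>2\<close>. The
  condition \<open>c \<le> 1\<close> keeps both exponents in the range of that bound.\<close>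

lemma two_point_exp_bound:
  fixes a b :: real
  assumes "0 \<le> \<rho>" "\<rho> \<le> 1" "\<bar>b - a\<bar> \<le> c" "c \<le> 1"
  shows "(1 - \<rho>) * exp a + \<rho> * exp b \<le> exp ((1 - \<rho>) * a + \<rho> * b + c\<^sup>2)"
proof -
  define d where "d = b - a"
  define g where "g = (1 - \<rho>) * a + \<rho> * b"
  have ag: "a = g + - \<rho> * d" and bg: "b = g + (1 - \<rho>) * d"
    by (auto simp: d_def g_def algebra_simps)
  have d: "\<bar>d\<bar> \<le> c" using assms by (simp add: d_def)
  have 1: "\<bar>- \<rho> * d\<bar> \<le> 1"
    using assms d mult_mono[of "\<bar>\<rho>\<bar>" 1 "\<bar>d\<bar>" 1] by (simp add: abs_mult)
  have 2: "\<bar>(1 - \<rho>) * d\<bar> \<le> 1"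
    using assms d mult_mono[of "\<bar>1 - \<rho>\<bar>" 1 "\<bar>d\<bar>" 1] by (simp add: abs_mult)
  have "(1 - \<rho>) * exp (- \<rho> * d) + \<rho> * exp ((1 - \<rho>) * d)
     \<le> (1 - \<rho>) * (1 + - \<rho> * d + (- \<rho> * d)\<^sup>2) + \<rho> * (1 + (1 - \<rho>) * d + ((1 - \<rho>) * d)\<^sup>2)"
    using assms by (intro add_mono mult_left_mono exp_le_quadratic 1 2) auto
  also have "\<dots> = 1 + \<rho> * (1 - \<rho>) * d\<^sup>2"
    by (simp add: algebra_simps power2_eq_square)
  also have "\<dots> \<le> 1 + 1 * c\<^sup>2"
    using assms d by (intro add_left_mono mult_mono) (auto simp: mult_le_one abs_le_square_iff[symmetric])
  also have "\<dots> \<le> exp (c\<^sup>2)" by simp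
  finally have "exp g * ((1 - \<rho>) * exp (- \<rho> * d) + \<rho> * exp ((1 - \<rho>) * d)) \<le> exp g * exp (c\<^sup>2)"
    by (intro mult_left_mono) auto
  moreover have "(1 - \<rho>) * exp a + \<rho> * exp b
      = exp g * ((1 - \<rho>) * exp (- \<rho> * d) + \<rho> * exp ((1 - \<rho>) * d))"
    unfolding distrib_left mult.left_commute[of "exp g"] exp_add[symmetric] by (simp only: ag[symmetric] bg[symmetric])
  ultimately show ?thesis by (simp add: exp_add g_def)
qed

text \<open>Averaging out one element preserves the increment bounds of all the others, so elements
  can be removed successively, each at the cost of a factor \<open>exp ((c e)\<^sup>2)\<close> from
  the two-point bound.\<close>

lemma bernoulli_mean_exp_le:
  assumes "finite P"
    and "0 \<le> \<rho>" "\<rho> \<le> 1"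
    and "\<And>e X. \<lbrakk>e \<in> P; X \<subseteq> P; e \<notin> X\<rbrakk> \<Longrightarrow> \<bar>f (insert e X) - f X\<bar> \<le> c e"
    and "\<And>e. e \<in> P \<Longrightarrow> c e \<le> 1"
  shows "bernoulli_mean \<rho> P (\<lambda>X. exp (f X)) \<le> exp (bernoulli_mean \<rho> P f + (\<Sum>e\<in>P. (c e)\<^sup>2))"
  using assms
proof (induction P arbitrary: f rule: finite_induct)
  case empty
  then show ?case by (simp add: bernoulli_mean_def)
next
  case (insert e P)
  define g where "g X = (1 - \<rho>) * f X + \<rho> * f (insert e X)" for X
  have "bernoulli_mean \<rho> (insert e P) (\<lambda>X. exp (f X))
      = bernoulli_mean \<rho> P (\<lambda>X. (1 - \<rho>) * exp (f X) + \<rho> * exp (f (insert e X)))"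
    by (rule bernoulli_mean_insert[OF insert.hyps])
  also have "\<dots> \<le> bernoulli_mean \<rho> P (\<lambda>X. exp ((c e)\<^sup>2) * exp (g X))"
  proof (rule bernoulli_mean_mono)
    fix X assume "X \<subseteq> P"
    then have "\<bar>f (insert e X) - f X\<bar> \<le> c e"
      using insert.hyps by (intro insert.prems) auto
    then show "(1 - \<rho>) * exp (f X) + \<rho> * exp (f (insert e X)) \<le> exp ((c e)\<^sup>2) * exp (g X)"
      using two_point_exp_bound[of \<rho> "f (insert e X)" "f X" "c e"] insert.prems
      by (simp add: g_def exp_add mult.commute)
  qed (use insert.prems in auto)
  also have "\<dots> = exp ((c e)\<^sup>2) * bernoulli_mean \<rho> P (\<lambda>X. exp (g X))"
    by (rule bernoulli_mean_cmult)
  also have "\<dots> \<le> exp ((c e)\<^sup>2) * exp (bernoulli_mean \<rho> P g + (\<Sum>e\<in>P. (c e)\<^sup>2))"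
  proof (intro mult_left_mono insert.IH)
    fix a X assume a: "a \<in> P" "X \<subseteq> P" "a \<notin> X"
    then have "a \<noteq> e" using insert.hyps by auto
    then have 1: "\<bar>f (insert a (insert e X)) - f (insert e X)\<bar> \<le> c a"
      using a by (intro insert.prems) auto
    have 2: "\<bar>f (insert a X) - f X\<bar> \<le> c a"
      using a by (intro insert.prems) auto
    have "g (insert a X) - g X = (1 - \<rho>) * (f (insert a X) - f X)
        + \<rho> * (f (insert a (insert e X)) - f (insert e X))"
      by (simp add: g_def insert_commute[of e a] algebra_simps)
    also have "\<bar>\<dots>\<bar> \<le> (1 - \<rho>) * \<bar>f (insert a X) - f X\<bar>
        + \<rho> * \<bar>f (insert a (insert e X)) - f (insert e X)\<bar>"
      using insert.prems(1,2) by (intro order_trans[OF abs_triangle_ineq]) (simp add: abs_mult)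
    also have "\<dots> \<le> (1 - \<rho>) * c a + \<rho> * c a"
      using 1 2 insert.prems(1,2) by (intro add_mono mult_left_mono) auto
    finally show "\<bar>g (insert a X) - g X\<bar> \<le> c a" by (simp add: algebra_simps)
  qed (use insert.prems in auto)
  also have "\<dots> = exp (bernoulli_mean \<rho> (insert e P) f + (\<Sum>e\<in>insert e P. (c e)\<^sup>2))"
    using insert.hyps by (simp add: bernoulli_mean_insert[OF insert.hyps] g_def[abs_def] exp_add)
  finally show ?case .
qed

subsection \<open>Bottlenecks of Markov chains\<close>

lemma sum_kpow:
  assumes "finite S" "markov_kernel S P" "x \<in> S"
  shows "(\<Sum>y\<in>S. kpow S P t x y) = 1"
proof (induction t)
  case 0
  then show ?case using assms by simp
next
  case (Suc t)
  have "(\<Sum>y\<in>S. kpow S P (Suc t) x y) = (\<Sum>z\<in>S. \<Sum>y\<in>S. kpow S P t x z * P z y)"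
    by simp (rule sum.swap)
  also have "\<dots> = (\<Sum>z\<in>S. kpow S P t x z)"
    using assms by (intro sum.cong) (auto simp: markov_kernel_def simp flip: sum_distrib_left)
  finally show ?case using Suc by simp
qed

lemma kpow_nonneg:
  assumes "markov_kernel S P" "y \<in> S"
  shows "0 \<le> kpow S P t x y"
  using assms(2)
proof (induction t arbitrary: y)
  case (Suc t)
  then show ?case using assms(1) by (auto simp: markov_kernel_def intro!: sum_nonneg mult_nonneg_nonneg)
qed auto

text \<open>Since the total masses agree, the excess of \<open>\<mu>\<close> over
  \<open>\<nu>\<close> on \<open>A\<close> equals its deficit on \<open>S - A\<close>. Both are
  bounded by disjoint parts of the same sum, which accounts for the factor one half.\<close>

lemma sum_subset_le_tv_dist:
  assumes "finite S" "A \<subseteq> S" "(\<Sum>y\<in>S. \<mu> y) = (\<Sum>y\<in>S. \<nu> y)"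
  shows "(\<Sum>y\<in>A. \<mu> y) - (\<Sum>y\<in>A. \<nu> y) \<le> tv_dist S \<mu> \<nu>"
proof -
  let ?d = "\<lambda>y. \<mu> y - \<nu> y"
  have split: "sum f S = sum f A + sum f (S - A)" for f :: "'a \<Rightarrow> real"
    using assms by (metis add.commute sum.subset_diff)
  have "sum ?d A \<le> (\<Sum>y\<in>A. \<bar>?d y\<bar>)" "- sum ?d (S - A) \<le> (\<Sum>y\<in>S - A. \<bar>?d y\<bar>)"
    unfolding sum_negf[symmetric] by (intro sum_mono; simp)+
  moreover have "sum ?d A = - sum ?d (S - A)"
    using split[of ?d] assms(3) by (simp add: sum_subtractf)
  ultimately show ?thesis
    unfolding tv_dist_def split by (simp add: sum_subtractf)
qed

text \<open>Started from \<open>\<pi>\<close> restricted to \<open>A\<close>, the law stays below \<open>\<pi>\<close>, so each step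
  loses at most the mass \<open>\<pi>(F)\<close> of the inner boundary \<open>F\<close> of \<open>A\<close>.\<close>

lemma mixing_time_ge_bottleneck:
  fixes \<pi> :: "'a \<Rightarrow> real"
  assumes fin: "finite S" and mk: "markov_kernel S P" and st: "stationary S P \<pi>"
    and pos: "\<And>x. x \<in> S \<Longrightarrow> 0 \<le> \<pi> x" and one: "(\<Sum>x\<in>S. \<pi> x) = 1"
    and AS: "A \<subseteq> S" and FA: "F \<subseteq> A"
    and noesc: "\<And>x y. \<lbrakk>x \<in> A - F; y \<in> S - A\<rbrakk> \<Longrightarrow> P x y = 0"
    and Apos: "0 < (\<Sum>x\<in>A. \<pi> x)" and Ahalf: "(\<Sum>x\<in>A. \<pi> x) \<le> 1/2"
    and bdry: "(\<Sum>x\<in>F. \<pi> x) \<le> \<epsilon> * (\<Sum>x\<in>A. \<pi> x)" and M: "\<epsilon> * M \<le> 1/10"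
  shows "ereal M \<le> ereal_of_enat (mixing_time S P \<pi>)"
proof -
  define \<mu> where "\<mu> t y = (\<Sum>x\<in>A. \<pi> x * kpow S P t x y)" for t y
  have finA: "finite A" using fin AS finite_subset by auto
  have Pnn: "0 \<le> P x y" if "x \<in> S" "y \<in> S" for x y
    using mk that by (auto simp: markov_kernel_def)
  have \<mu>_nonneg: "0 \<le> \<mu> t y" if "y \<in> S" for t y
    unfolding \<mu>_def using that AS pos kpow_nonneg[OF mk]
    by (intro sum_nonneg mult_nonneg_nonneg) auto
  have \<mu>_Suc: "\<mu> (Suc t) y = (\<Sum>z\<in>S. \<mu> t z * P z y)" for t y
    unfolding \<mu>_def by (simp add: sum_distrib_left sum_distrib_right sum.swap[of _ A S] mult.assoc)
  have \<mu>_le: "\<mu> t y \<le> \<pi> y" if "y \<in> S" for t y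
    using that
  proof (induction t arbitrary: y)
    case 0
    have "\<mu> 0 y = (\<Sum>x\<in>A. if x = y then \<pi> x else 0)"
      unfolding \<mu>_def by (rule sum.cong) auto
    then show ?case using finA pos[OF 0] by simp
  next
    case (Suc t)
    have "\<mu> (Suc t) y \<le> (\<Sum>z\<in>S. \<pi> z * P z y)"
      unfolding \<mu>_Suc using Suc Pnn by (intro sum_mono mult_right_mono) auto
    also have "\<dots> = \<pi> y" using st Suc.prems by (auto simp: stationary_def)
    finally show ?case .
  qed
  have stay: "(\<Sum>y\<in>A. \<pi> y) - real t * (\<Sum>y\<in>F. \<pi> y) \<le> (\<Sum>y\<in>A. \<mu> t y)" for t
  proof (induction t)
    case 0
    have "(\<Sum>y\<in>A. \<mu> 0 y) = (\<Sum>x\<in>A. \<pi> x)"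
      unfolding \<mu>_def using finA
      by (intro sum.cong refl) (simp add: if_distrib[of "\<lambda>z. _ * z"] cong: if_cong)
    then show ?case by simp
  next
    case (Suc t)
    have full: "(\<Sum>y\<in>A. P z y) = 1" if "z \<in> A - F" for z
    proof -
      have "(\<Sum>y\<in>A. P z y) = (\<Sum>y\<in>S. P z y)"
        using fin AS noesc[OF that] by (intro sum.mono_neutral_left) auto
      then show ?thesis using mk that AS by (auto simp: markov_kernel_def)
    qed
    have "(\<Sum>y\<in>A. \<mu> t y) - (\<Sum>y\<in>F. \<pi> y) \<le> (\<Sum>y\<in>A. \<mu> t y) - (\<Sum>y\<in>F. \<mu> t y)"
      using FA AS \<mu>_le by (intro diff_left_mono sum_mono) auto
    also have "\<dots> = (\<Sum>z\<in>A - F. \<mu> t z)"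
      using FA finA by (simp add: sum_diff)
    also have "\<dots> = (\<Sum>z\<in>A - F. \<mu> t z * (\<Sum>y\<in>A. P z y))"
      using full by simp
    also have "\<dots> \<le> (\<Sum>z\<in>S. \<mu> t z * (\<Sum>y\<in>A. P z y))"
      using fin AS \<mu>_nonneg Pnn
      by (intro sum_mono2) (auto intro!: mult_nonneg_nonneg sum_nonneg)
    also have "\<dots> = (\<Sum>y\<in>A. \<mu> (Suc t) y)"
      unfolding \<mu>_Suc sum_distrib_left by (rule sum.swap)
    finally show ?case using Suc by (simp add: algebra_simps)
  qed
  have "M \<le> real t" if t: "\<forall>x\<in>S. tv_dist S (kpow S P t x) \<pi> \<le> exp (-1)" for t
  proof -
    define a where "a = (\<Sum>x\<in>A. \<pi> x)"
    \<comment> \<open>Averaging the mixing hypothesis over starting points in \<open>A\<close> with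
      weights \<open>\<pi>\<close> limits the mass still in \<open>A\<close> at time
      \<open>t\<close>. For small \<open>t\<close> this conflicts with \<open>stay\<close>.\<close>
    have "(\<Sum>y\<in>A. \<mu> t y) - a * a = (\<Sum>x\<in>A. \<pi> x * ((\<Sum>y\<in>A. kpow S P t x y) - a))"
      unfolding \<mu>_def right_diff_distrib sum_subtractf sum_distrib_left sum_distrib_right[symmetric]
      by (subst sum.swap) (simp add: a_def)
    also have "\<dots> \<le> (\<Sum>x\<in>A. \<pi> x * exp (-1))"
    proof (intro sum_mono mult_left_mono)
      fix x assume "x \<in> A"
      then have x: "x \<in> S" using AS by auto
      show "(\<Sum>y\<in>A. kpow S P t x y) - a \<le> exp (-1)"
        using sum_subset_le_tv_dist[OF fin AS, of "kpow S P t x" \<pi>] sum_kpow[OF fin mk x] one t x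
        by (force simp: a_def)
      show "0 \<le> \<pi> x" using pos x by auto
    qed
    finally have "(\<Sum>y\<in>A. \<mu> t y) \<le> a * a + a * exp (-1)"
      by (simp add: a_def sum_distrib_right)
    moreover have "a - real t * (\<epsilon> * a) \<le> a - real t * (\<Sum>y\<in>F. \<pi> y)"
      using bdry unfolding a_def by (intro diff_left_mono mult_left_mono) auto
    ultimately have "a - real t * (\<epsilon> * a) \<le> a * a + a * exp (-1)"
      using stay[of t] by (simp add: a_def)
    then have "a * (1 - real t * \<epsilon>) \<le> a * (a + exp (-1))"
      by (simp add: algebra_simps)
    then have 1: "1 - real t * \<epsilon> \<le> 1/2 + exp (-1)"
      using Apos Ahalf unfolding a_def[symmetric] by (simp add: mult_le_cancel_left_pos)
    \<comment> \<open>With \<open>a\<close> at most \<open>1/2\<close> and \<open>exp (-1)\<close>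
      at most \<open>2/5\<close>, the escaped fraction is at least
      \<open>1 - 1/2 - 2/5 = 1/10\<close>. This is the source of \<open>1/10\<close> in the
      hypothesis on \<open>M\<close>.\<close>
    have "5/2 \<le> exp (1::real)"
      using exp_lower_Taylor_quadratic[of 1] by simp
    then have "exp (-1::real) \<le> 2/5"
      by (simp add: exp_minus inverse_eq_divide field_simps)
    with 1 have 2: "1/10 \<le> real t * \<epsilon>" by simp
    then have "\<epsilon> > 0"
      using mult_nonneg_nonpos[of "real t" \<epsilon>] by (cases "\<epsilon> \<le> 0") auto
    moreover have "\<epsilon> * M \<le> \<epsilon> * real t" using M 2 by (simp add: mult.commute)
    ultimately show "M \<le> real t" by simp
  qed
  then have *: "ereal M \<le> ereal_of_enat n"
    if "n \<in> enat ` {t. \<forall>x\<in>S. tv_dist S (kpow S P t x) \<pi> \<le> exp (-1)}" for n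
    using that by auto
  \<comment> \<open>If no time is admissible, the mixing time is infinite; otherwise the infimum is
    attained.\<close>
  show ?thesis
  proof (cases "{t. \<forall>x\<in>S. tv_dist S (kpow S P t x) \<pi> \<le> exp (-1)} = {}")
    case True
    then show ?thesis by (simp add: mixing_time_def Inf_enat_def)
  next
    case False
    then have "mixing_time S P \<pi> \<in> enat ` {t. \<forall>x\<in>S. tv_dist S (kpow S P t x) \<pi> \<le> exp (-1)}"
      (is "_ \<in> ?T")
      unfolding mixing_time_def Inf_enat_def using LeastI_ex[of "\<lambda>x. x \<in> ?T"] by fastforce
    then show ?thesis by (rule *)
  qed
qed

subsection \<open>Wells of a supermodular energy\<close>

lemma sum_UN_le:
  fixes f :: "'a \<Rightarrow> real"
  assumes "finite I" "\<And>i. i \<in> I \<Longrightarrow> finite (A i)" "\<And>x. 0 \<le> f x"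
  shows "sum f (\<Union>i\<in>I. A i) \<le> (\<Sum>i\<in>I. sum f (A i))"
  using assms(1,2)
proof (induction I rule: finite_induct)
  case (insert i I)
  have "sum f (A i \<union> (\<Union>i\<in>I. A i)) \<le> sum f (A i) + sum f (\<Union>i\<in>I. A i)"
    using insert assms(3) by (subst sum_Un) (auto intro: sum_nonneg)
  then show ?case using insert by force
qed simp

text \<open>Both states of \<open>e\<close> are forced, so the value does not depend on whether
  \<open>e\<close> lies in \<open>X\<close>. Under weights \<open>exp (H X)\<close> it is the log
  odds of \<open>e\<close> given all other elements.\<close>

definition discrete_deriv :: "('a set \<Rightarrow> real) \<Rightarrow> 'a \<Rightarrow> 'a set \<Rightarrow> real" where
  "discrete_deriv H e X = H (insert e X) - H (X - {e})"

text \<open>\<open>c e a\<close> bounds the influence of \<open>a\<close> on the derivative at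
  \<open>e\<close>. The uniform bound \<open>\<kappa>\<close> controls the effect of a few flips,
  while \<open>V\<close> plays the role of the variance in the concentration estimate.\<close>

locale supermodular_energy =
  fixes P :: "'a set" and H :: "'a set \<Rightarrow> real" and c :: "'a \<Rightarrow> 'a \<Rightarrow> real" and \<kappa> V :: real
  assumes finite_P: "finite P"
    and mono: "\<lbrakk>e \<in> P; X \<subseteq> Y; Y \<subseteq> P\<rbrakk> \<Longrightarrow> discrete_deriv H e X \<le> discrete_deriv H e Y"
    and lipschitz: "\<lbrakk>e \<in> P; a \<in> P; X \<subseteq> P; a \<notin> X\<rbrakk> \<Longrightarrow>
      \<bar>discrete_deriv H e (insert a X) - discrete_deriv H e X\<bar> \<le> c e a"
    and c_le: "\<lbrakk>e \<in> P; a \<in> P\<rbrakk> \<Longrightarrow> c e a \<le> \<kappa>"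
    and sum_c_le: "e \<in> P \<Longrightarrow> (\<Sum>a\<in>P. (c e a)\<^sup>2) \<le> V"
begin

definition lower_well :: "real \<Rightarrow> 'a set set" where
  "lower_well \<theta> = {X \<in> Pow P. \<forall>e\<in>P. discrete_deriv H e X \<le> \<theta>}"

definition upper_well :: "real \<Rightarrow> 'a set set" where
  "upper_well \<theta> = {X \<in> Pow P. \<forall>e\<in>P. \<theta> \<le> discrete_deriv H e X}"

lemma discrete_deriv_complement:
  assumes "e \<in> P" "X \<subseteq> P"
  shows "discrete_deriv (\<lambda>X. H (P - X)) e X = - discrete_deriv H e (P - X)"
proof -
  have "P - insert e X = P - X - {e}" "P - (X - {e}) = insert e (P - X)"
    using assms by auto
  then show ?thesis by (simp add: discrete_deriv_def)
qed

text \<open>Complementation reverses both the inclusion order and the sign of the derivative, so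
  monotonicity survives with the same influences.\<close>

lemma complement: "supermodular_energy P (\<lambda>X. H (P - X)) c \<kappa> V"
proof
  fix e X Y assume "e \<in> P" "X \<subseteq> Y" "Y \<subseteq> P"
  then show "discrete_deriv (\<lambda>X. H (P - X)) e X \<le> discrete_deriv (\<lambda>X. H (P - X)) e Y"
    by (subst (1 2) discrete_deriv_complement) (auto intro!: mono)
next
  fix e a X assume *: "e \<in> P" "a \<in> P" "X \<subseteq> P" "a \<notin> X"
  have "insert a (P - insert a X) = P - X" using * by auto
  with * lipschitz[of e a "P - insert a X"]
  show "\<bar>discrete_deriv (\<lambda>X. H (P - X)) e (insert a X) - discrete_deriv (\<lambda>X. H (P - X)) e X\<bar> \<le> c e a"
    by (subst (1 2) discrete_deriv_complement) auto
qed (auto intro: finite_P c_le sum_c_le)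

text \<open>Passing from \<open>X\<close> to \<open>Y\<close> through \<open>X \<union> Y\<close>,
  each added element raises the derivative by at most \<open>\<kappa>\<close>, and the removals that
  follow can only lower it.\<close>

lemma discrete_deriv_le_flips:
  assumes "e \<in> P" "X \<subseteq> P" "Y \<subseteq> P"
  shows "discrete_deriv H e Y \<le> discrete_deriv H e X + \<kappa> * real (card (Y - X))"
proof -
  have "discrete_deriv H e (X \<union> Z) \<le> discrete_deriv H e X + \<kappa> * real (card Z)"
    if "finite Z" "Z \<subseteq> P - X" for Z
    using that
  proof (induction Z rule: finite_induct)
    case (insert a Z)
    have "\<bar>discrete_deriv H e (insert a (X \<union> Z)) - discrete_deriv H e (X \<union> Z)\<bar> \<le> c e a"
      using insert assms by (intro lipschitz) auto
    then have "discrete_deriv H e (insert a (X \<union> Z)) \<le> discrete_deriv H e (X \<union> Z) + \<kappa>"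
      using c_le[of e a] insert.prems assms by auto
    then show ?case using insert by (simp add: algebra_simps)
  qed simp
  from this[of "Y - X"] have "discrete_deriv H e (X \<union> Y) \<le> discrete_deriv H e X + \<kappa> * real (card (Y - X))"
    using assms finite_subset[OF assms(3) finite_P] by (simp add: Diff_mono)
  moreover have "discrete_deriv H e Y \<le> discrete_deriv H e (X \<union> Y)"
    using assms by (intro mono) auto
  ultimately show ?thesis by simp
qed

text \<open>By monotonicity the derivative at the empty set is at most its mean. This guarantees
  that the well has positive mass.\<close>

lemma empty_in_lower_well:
  assumes "0 \<le> \<rho>" "\<rho> \<le> 1"
    and "\<And>e. e \<in> P \<Longrightarrow> bernoulli_mean \<rho> P (discrete_deriv H e) \<le> \<theta>"
  shows "{} \<in> lower_well \<theta>"
proof -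
  have "discrete_deriv H e {} \<le> \<theta>" if "e \<in> P" for e
  proof -
    have "bernoulli_mean \<rho> P (\<lambda>X. discrete_deriv H e {}) \<le> bernoulli_mean \<rho> P (discrete_deriv H e)"
      using assms that by (intro bernoulli_mean_mono mono) auto
    then show ?thesis using assms(3)[OF that] by (simp add: bernoulli_mean_const finite_P)
  qed
  then show ?thesis by (simp add: lower_well_def)
qed

text \<open>Inside the well every edge has conditional probability at most the logistic value
  \<open>\<rho>\<close> of \<open>\<theta>\<close>, because the well is closed under removing edges.\<close>

lemma lower_well_boundary:
  assumes \<rho>: "\<rho> = exp \<theta> / (1 + exp \<theta>)" and \<tau>: "0 \<le> \<tau>" "\<tau> * \<kappa> \<le> 1"
    and mean: "\<And>e. e \<in> P \<Longrightarrow> bernoulli_mean \<rho> P (discrete_deriv H e) \<le> \<theta> - 2 * \<delta>"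
  shows "(\<Sum>X | X \<in> lower_well \<theta> \<and> (\<exists>e\<in>P. \<theta> - \<delta> \<le> discrete_deriv H e X). exp (H X))
    \<le> real (card P) * exp (\<tau>\<^sup>2 * V - \<tau> * \<delta>) * (\<Sum>X\<in>lower_well \<theta>. exp (H X))"
proof -
  let ?W = "\<Sum>X\<in>lower_well \<theta>. exp (H X)"
  have \<rho>01: "0 \<le> \<rho>" "\<rho> \<le> 1"
    unfolding \<rho> by (auto simp: field_simps add_pos_pos intro: order_less_imp_le)
  have \<rho>': "(1 - \<rho>) * exp \<theta> = \<rho>"
    unfolding \<rho> using add_pos_pos[OF zero_less_one exp_gt_zero[of \<theta>]] by (simp add: field_simps)
  have sub: "lower_well \<theta> \<subseteq> Pow P" by (auto simp: lower_well_def)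
  have finw: "finite (lower_well \<theta>)" using finite_subset[OF sub] finite_P by auto
  define \<mu> where "\<mu> X = (if X \<in> lower_well \<theta> then exp (H X) else 0)" for X
  have sum\<mu>: "(\<Sum>X\<in>Pow P. \<mu> X * g X) = (\<Sum>X\<in>lower_well \<theta>. exp (H X) * g X)" for g
    using sub finite_P by (intro sum.mono_neutral_cong_right) (auto simp: \<mu>_def)
  have one: "(\<Sum>X | X \<in> lower_well \<theta> \<and> \<theta> - \<delta> \<le> discrete_deriv H e X. exp (H X))
      \<le> exp (\<tau>\<^sup>2 * V - \<tau> * \<delta>) * ?W" if e: "e \<in> P" for e
  proof -
    let ?f = "\<lambda>X. \<tau> * discrete_deriv H e X"
    \<comment> \<open>Chernoff bound: the inserted factor is at least 1 on the event, and all of the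
      well may then be summed.\<close>
    have "(\<Sum>X | X \<in> lower_well \<theta> \<and> \<theta> - \<delta> \<le> discrete_deriv H e X. exp (H X))
       \<le> (\<Sum>X | X \<in> lower_well \<theta> \<and> \<theta> - \<delta> \<le> discrete_deriv H e X.
             exp (H X) * exp (\<tau> * (discrete_deriv H e X - (\<theta> - \<delta>))))"
      using \<tau> by (intro sum_mono) auto
    also have "\<dots> \<le> (\<Sum>X\<in>lower_well \<theta>. exp (H X) * exp (\<tau> * (discrete_deriv H e X - (\<theta> - \<delta>))))"
      using finw by (intro sum_mono2) auto
    also have "\<dots> = (\<Sum>X\<in>Pow P. \<mu> X * exp (?f X)) * exp (- \<tau> * (\<theta> - \<delta>))"
      unfolding sum\<mu> sum_distrib_right
      by (intro sum.cong) (auto simp: algebra_simps simp flip: exp_add)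
    \<comment> \<open>The exponential of the derivative is an increasing function, so stochastic
      domination replaces the conditioned measure by the product measure.\<close>
    also have "\<dots> \<le> ((\<Sum>X\<in>Pow P. \<mu> X) * bernoulli_mean \<rho> P (\<lambda>X. exp (?f X))) * exp (- \<tau> * (\<theta> - \<delta>))"
    proof (intro mult_right_mono sum_le_bernoulli_mean finite_P \<rho>01)
      fix a X assume a: "a \<in> P" "X \<subseteq> P" "a \<notin> X"
      show "exp (?f X) \<le> exp (?f (insert a X))"
        using a e \<tau> mono[of e X "insert a X"] by (auto intro!: mult_left_mono)
      show "(1 - \<rho>) * \<mu> (insert a X) \<le> \<rho> * \<mu> X"
      proof (cases "insert a X \<in> lower_well \<theta>")
        case True
        have "discrete_deriv H b X \<le> \<theta>" if "b \<in> P" for b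
          using True that a mono[of b X "insert a X"] by (fastforce simp: lower_well_def)
        then have X: "X \<in> lower_well \<theta>" using a by (simp add: lower_well_def)
        have "discrete_deriv H a (insert a X) \<le> \<theta>" using True a by (auto simp: lower_well_def)
        then have "H (insert a X) \<le> \<theta> + H X" using a by (simp add: discrete_deriv_def)
        then have "(1 - \<rho>) * exp (H (insert a X)) \<le> (1 - \<rho>) * exp (\<theta> + H X)"
          using \<rho>01 by (intro mult_left_mono) auto
        also have "\<dots> = \<rho> * exp (H X)" unfolding exp_add mult.assoc[symmetric] \<rho>' ..
        finally show ?thesis using True X by (simp add: \<mu>_def)
      next
        case False
        then show ?thesis using \<rho>01 by (simp add: \<mu>_def)
      qed
    qed (auto simp: \<mu>_def)
    also have "(\<Sum>X\<in>Pow P. \<mu> X) = ?W" using sum\<mu>[of "\<lambda>_. 1"] by simp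
    \<comment> \<open>The mean lies \<open>2 * \<delta>\<close> below \<open>\<theta>\<close> while
      the threshold is only \<open>\<delta>\<close> below it; the difference leaves
      \<open>- \<tau> * \<delta>\<close> in the exponent, against the fluctuation term
      \<open>\<tau>\<^sup>2 * V\<close>.\<close>
    also have "?W * bernoulli_mean \<rho> P (\<lambda>X. exp (?f X)) * exp (- \<tau> * (\<theta> - \<delta>))
       \<le> ?W * exp (\<tau> * (\<theta> - 2 * \<delta>) + \<tau>\<^sup>2 * V) * exp (- \<tau> * (\<theta> - \<delta>))"
    proof (intro mult_right_mono mult_left_mono)
      have "bernoulli_mean \<rho> P (\<lambda>X. exp (?f X))
          \<le> exp (bernoulli_mean \<rho> P ?f + (\<Sum>a\<in>P. (\<tau> * c e a)\<^sup>2))"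
      proof (intro bernoulli_mean_exp_le finite_P \<rho>01)
        fix a X assume a: "a \<in> P" "X \<subseteq> P" "a \<notin> X"
        have "\<bar>?f (insert a X) - ?f X\<bar> = \<tau> * \<bar>discrete_deriv H e (insert a X) - discrete_deriv H e X\<bar>"
          using \<tau> by (simp add: abs_mult flip: right_diff_distrib)
        also have "\<dots> \<le> \<tau> * c e a" using a e \<tau> by (intro mult_left_mono lipschitz) auto
        finally show "\<bar>?f (insert a X) - ?f X\<bar> \<le> \<tau> * c e a" .
      next
        fix a assume "a \<in> P"
        then show "\<tau> * c e a \<le> 1" using e \<tau> c_le[of e a] mult_left_mono[of "c e a" \<kappa> \<tau>] by simp
      qed
      also have "\<dots> \<le> exp (\<tau> * (\<theta> - 2 * \<delta>) + \<tau>\<^sup>2 * V)"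
        unfolding exp_le_cancel_iff bernoulli_mean_cmult power_mult_distrib sum_distrib_left[symmetric]
        using e \<tau> mean sum_c_le by (intro add_mono mult_left_mono) auto
      finally show "bernoulli_mean \<rho> P (\<lambda>X. exp (?f X)) \<le> exp (\<tau> * (\<theta> - 2 * \<delta>) + \<tau>\<^sup>2 * V)" .
    qed (auto intro: sum_nonneg)
    also have "\<dots> = exp (\<tau>\<^sup>2 * V - \<tau> * \<delta>) * ?W"
      by (simp add: algebra_simps flip: exp_add)
    finally show ?thesis .
  qed
  \<comment> \<open>A union bound over \<open>e\<close> produces the factor
    \<open>card P\<close>.\<close>
  have "(\<Sum>X | X \<in> lower_well \<theta> \<and> (\<exists>e\<in>P. \<theta> - \<delta> \<le> discrete_deriv H e X). exp (H X))
      = (\<Sum>X\<in>(\<Union>e\<in>P. {X. X \<in> lower_well \<theta> \<and> \<theta> - \<delta> \<le> discrete_deriv H e X}). exp (H X))"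
    by (rule sum.cong) auto
  also have "\<dots> \<le> (\<Sum>e\<in>P. \<Sum>X | X \<in> lower_well \<theta> \<and> \<theta> - \<delta> \<le> discrete_deriv H e X. exp (H X))"
    using finw finite_P by (intro sum_UN_le) auto
  also have "\<dots> \<le> (\<Sum>e\<in>P. exp (\<tau>\<^sup>2 * V - \<tau> * \<delta>) * ?W)"
    by (intro sum_mono one)
  finally show ?thesis by (simp add: mult.assoc)
qed

lemma lower_well_complement:
  "supermodular_energy.lower_well P (\<lambda>X. H (P - X)) \<theta> = (\<lambda>X. P - X) ` upper_well (- \<theta>)"
proof -
  interpret C: supermodular_energy P "\<lambda>X. H (P - X)" c \<kappa> V by (rule complement)
  show ?thesis
  proof (intro equalityI subsetI)
    fix X assume "X \<in> C.lower_well \<theta>"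
    then have "P - X \<in> upper_well (- \<theta>)" "X = P - (P - X)"
      by (auto simp: C.lower_well_def upper_well_def discrete_deriv_complement minus_le_iff)
    then show "X \<in> (\<lambda>X. P - X) ` upper_well (- \<theta>)" by blast
  next
    fix X assume "X \<in> (\<lambda>X. P - X) ` upper_well (- \<theta>)"
    then obtain Y where "Y \<in> upper_well (- \<theta>)" "X = P - Y" by auto
    moreover from this have "P - X = Y" by (auto simp: upper_well_def)
    ultimately show "X \<in> C.lower_well \<theta>"
      by (auto simp: C.lower_well_def upper_well_def discrete_deriv_complement minus_le_iff)
  qed
qed

lemma full_in_upper_well:
  assumes "0 \<le> \<rho>" "\<rho> \<le> 1"
    and "\<And>e. e \<in> P \<Longrightarrow> \<theta> \<le> bernoulli_mean \<rho> P (discrete_deriv H e)"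
  shows "P \<in> upper_well \<theta>"
proof -
  have "discrete_deriv H e P \<ge> \<theta>" if "e \<in> P" for e
  proof -
    have "bernoulli_mean \<rho> P (discrete_deriv H e) \<le> bernoulli_mean \<rho> P (\<lambda>X. discrete_deriv H e P)"
      using assms that by (intro bernoulli_mean_mono mono) auto
    then show ?thesis using assms(3)[OF that] by (simp add: bernoulli_mean_const finite_P)
  qed
  then show ?thesis by (simp add: upper_well_def)
qed

text \<open>The estimate for lower wells is applied to the complemented energy, with threshold
  \<open>- \<theta>\<close> and density \<open>1 - \<rho>\<close>.\<close>

lemma upper_well_boundary:
  assumes \<rho>: "\<rho> = exp \<theta> / (1 + exp \<theta>)" and \<tau>: "0 \<le> \<tau>" "\<tau> * \<kappa> \<le> 1"
    and mean: "\<And>e. e \<in> P \<Longrightarrow> \<theta> + 2 * \<delta> \<le> bernoulli_mean \<rho> P (discrete_deriv H e)"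
  shows "(\<Sum>X | X \<in> upper_well \<theta> \<and> (\<exists>e\<in>P. discrete_deriv H e X \<le> \<theta> + \<delta>). exp (H X))
    \<le> real (card P) * exp (\<tau>\<^sup>2 * V - \<tau> * \<delta>) * (\<Sum>X\<in>upper_well \<theta>. exp (H X))"
proof -
  interpret C: supermodular_energy P "\<lambda>X. H (P - X)" c \<kappa> V by (rule complement)
  \<comment> \<open>Symmetry of the logistic function: its values at \<open>\<theta>\<close> and
    \<open>- \<theta>\<close> add up to 1.\<close>
  have \<rho>': "1 - \<rho> = exp (- \<theta>) / (1 + exp (- \<theta>))"
    unfolding \<rho> using add_pos_pos[OF zero_less_one exp_gt_zero[of \<theta>]]
    by (simp add: exp_minus field_simps)
  have m: "bernoulli_mean (1 - \<rho>) P (discrete_deriv (\<lambda>X. H (P - X)) e) \<le> - \<theta> - 2 * \<delta>"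
    if e: "e \<in> P" for e
  proof -
    have "bernoulli_mean (1 - \<rho>) P (discrete_deriv (\<lambda>X. H (P - X)) e)
        = bernoulli_mean (1 - \<rho>) P (\<lambda>X. (- 1) * discrete_deriv H e (P - X))"
      unfolding bernoulli_mean_def using e
      by (intro sum.cong) (auto simp: discrete_deriv_complement)
    also have "\<dots> = - bernoulli_mean \<rho> P (discrete_deriv H e)"
      unfolding bernoulli_mean_cmult bernoulli_mean_complement by simp
    finally show ?thesis using mean[OF e] by simp
  qed
  have inj: "inj_on (\<lambda>X. P - X) A" if "A \<subseteq> Pow P" for A
    using that by (auto simp: inj_on_def)
  have sub: "upper_well \<theta> \<subseteq> Pow P" by (auto simp: upper_well_def)
  have sumW: "(\<Sum>X\<in>(\<lambda>X. P - X) ` A. exp (H (P - X))) = (\<Sum>X\<in>A. exp (H X))" if "A \<subseteq> Pow P" for A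
    unfolding sum.reindex[OF inj[OF that]] using that by (intro sum.cong) (auto simp: double_diff)
  have "{X. X \<in> C.lower_well (- \<theta>) \<and> (\<exists>e\<in>P. - \<theta> - \<delta> \<le> discrete_deriv (\<lambda>X. H (P - X)) e X)}
      = (\<lambda>X. P - X) ` {X. X \<in> upper_well \<theta> \<and> (\<exists>e\<in>P. discrete_deriv H e X \<le> \<theta> + \<delta>)}"
    (is "?L = ?R")
  proof (intro equalityI subsetI)
    fix X assume X: "X \<in> ?L"
    then have XP: "X \<subseteq> P" by (auto simp: C.lower_well_def)
    obtain Y where Y: "Y \<in> upper_well \<theta>" "X = P - Y"
      using X unfolding lower_well_complement by auto
    then have "P - X = Y" by (auto simp: upper_well_def)
    moreover obtain e where "e \<in> P" "- \<theta> - \<delta> \<le> discrete_deriv (\<lambda>X. H (P - X)) e X"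
      using X by auto
    ultimately have "\<exists>e\<in>P. discrete_deriv H e Y \<le> \<theta> + \<delta>"
      using XP by (intro bexI[of _ e]) (auto simp: discrete_deriv_complement)
    with Y show "X \<in> ?R" by blast
  next
    fix X assume "X \<in> ?R"
    then obtain Y e where Y: "Y \<in> upper_well \<theta>" "X = P - Y" "e \<in> P" "discrete_deriv H e Y \<le> \<theta> + \<delta>"
      by auto
    then have "P - X = Y" "X \<subseteq> P" by (auto simp: upper_well_def)
    with Y have "- \<theta> - \<delta> \<le> discrete_deriv (\<lambda>X. H (P - X)) e X"
      by (simp add: discrete_deriv_complement)
    moreover have "X \<in> C.lower_well (- \<theta>)" unfolding lower_well_complement using Y by auto
    ultimately show "X \<in> ?L" using Y by blast
  qed
  with C.lower_well_boundary[OF \<rho>' \<tau> m] show ?thesis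
    unfolding lower_well_complement using sub
    by (simp add: sumW) (subst (asm) sumW, auto)
qed

text \<open>The wells are disjoint, so one of them has stationary mass at most \<open>1/2\<close>
  and serves as the bottleneck set. The condition \<open>\<kappa> * k < \<delta>\<close> ensures
  that the chain can leave it only from the layer of width \<open>\<delta>\<close> at its
  boundary.\<close>

theorem mixing_time_ge_two_wells:
  assumes mk: "markov_kernel (Pow P) K"
    and st: "stationary (Pow P) K (\<lambda>X. exp (H X) / (\<Sum>Y\<in>Pow P. exp (H Y)))"
    and loc: "\<And>X Y. \<lbrakk>X \<in> Pow P; Y \<in> Pow P; K X Y > 0\<rbrakk> \<Longrightarrow> real (card ((X - Y) \<union> (Y - X))) \<le> k"
    and P: "P \<noteq> {}" and \<kappa>: "0 \<le> \<kappa>" "\<kappa> * k < \<delta>" and \<delta>: "0 \<le> \<delta>"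
    and \<theta>: "\<theta>\<^sub>1 < \<theta>\<^sub>2"
    and \<rho>1: "\<rho>\<^sub>1 = exp \<theta>\<^sub>1 / (1 + exp \<theta>\<^sub>1)" and \<rho>2: "\<rho>\<^sub>2 = exp \<theta>\<^sub>2 / (1 + exp \<theta>\<^sub>2)"
    and mean1: "\<And>e. e \<in> P \<Longrightarrow> bernoulli_mean \<rho>\<^sub>1 P (discrete_deriv H e) \<le> \<theta>\<^sub>1 - 2 * \<delta>"
    and mean2: "\<And>e. e \<in> P \<Longrightarrow> \<theta>\<^sub>2 + 2 * \<delta> \<le> bernoulli_mean \<rho>\<^sub>2 P (discrete_deriv H e)"
    and \<tau>: "0 \<le> \<tau>" "\<tau> * \<kappa> \<le> 1"
    and M: "real (card P) * exp (\<tau>\<^sup>2 * V - \<tau> * \<delta>) * M \<le> 1/10"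
  shows "ereal M \<le> ereal_of_enat
    (mixing_time (Pow P) K (\<lambda>X. exp (H X) / (\<Sum>Y\<in>Pow P. exp (H Y))))"
proof -
  let ?A = "lower_well \<theta>\<^sub>1" and ?B = "upper_well \<theta>\<^sub>2"
  let ?FA = "{X. X \<in> lower_well \<theta>\<^sub>1 \<and> (\<exists>e\<in>P. \<theta>\<^sub>1 - \<delta> \<le> discrete_deriv H e X)}"
  let ?FB = "{X. X \<in> upper_well \<theta>\<^sub>2 \<and> (\<exists>e\<in>P. discrete_deriv H e X \<le> \<theta>\<^sub>2 + \<delta>)}"
  define Z where "Z = (\<Sum>Y\<in>Pow P. exp (H Y))"
  define \<pi> where "\<pi> X = exp (H X) / Z" for X
  have fin: "finite (Pow P)" using finite_P by simp
  have Z: "Z > 0" unfolding Z_def using fin by (intro sum_pos) auto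
  have sum\<pi>: "sum \<pi> A = (\<Sum>X\<in>A. exp (H X)) / Z" for A
    by (simp add: \<pi>_def sum_divide_distrib)
  have one: "sum \<pi> (Pow P) = 1" unfolding sum\<pi> using Z by (simp add: Z_def)
  have AB: "?A \<inter> ?B = {}" using P \<theta> by (force simp: lower_well_def upper_well_def)
  have AS: "?A \<subseteq> Pow P" and BS: "?B \<subseteq> Pow P" by (auto simp: lower_well_def upper_well_def)
  have \<rho>01: "0 \<le> exp \<theta> / (1 + exp \<theta>)" "exp \<theta> / (1 + exp \<theta>) \<le> 1" for \<theta> :: real
    by (auto simp: field_simps add_pos_pos intro: order_less_imp_le)
  have small: "card ((X - Y) \<union> (Y - X)) \<ge> card (Y - X)" "card ((X - Y) \<union> (Y - X)) \<ge> card (X - Y)"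
    if "X \<subseteq> P" "Y \<subseteq> P" for X Y
    using that finite_P by (auto intro!: card_mono intro: finite_subset)
  \<comment> \<open>One transition moves every derivative by less than \<open>\<delta>\<close>, in
    either direction.\<close>
  have near: "discrete_deriv H e Y < discrete_deriv H e X + \<delta>"
      "discrete_deriv H e X < discrete_deriv H e Y + \<delta>"
    if "X \<subseteq> P" "Y \<subseteq> P" "K X Y \<noteq> 0" "e \<in> P" for X Y e
  proof -
    have "K X Y > 0" using that mk by (force simp: markov_kernel_def less_le)
    then have "real (card ((X - Y) \<union> (Y - X))) \<le> k" using that by (intro loc) auto
    then have "real (card (Y - X)) \<le> k" "real (card (X - Y)) \<le> k"
      using small[OF that(1,2)] by linarith+
    then have "\<kappa> * real (card (Y - X)) < \<delta>" "\<kappa> * real (card (X - Y)) < \<delta>"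
      using \<kappa> mult_left_mono[of _ k \<kappa>] by (meson order_le_less_trans)+
    then show "discrete_deriv H e Y < discrete_deriv H e X + \<delta>"
      "discrete_deriv H e X < discrete_deriv H e Y + \<delta>"
      using discrete_deriv_le_flips[of e X Y] discrete_deriv_le_flips[of e Y X] that by auto
  qed
  have pos: "sum \<pi> A > 0" if "A \<subseteq> Pow P" "A \<noteq> {}" for A
    using that fin Z finite_subset unfolding \<pi>_def by (intro sum_pos) auto
  have scale: "sum \<pi> F \<le> \<epsilon> * sum \<pi> A" if "(\<Sum>X\<in>F. exp (H X)) \<le> \<epsilon> * (\<Sum>X\<in>A. exp (H X))" for F A \<epsilon>
    unfolding sum\<pi> using that Z by (simp add: divide_right_mono)
  have "sum \<pi> ?A + sum \<pi> ?B = sum \<pi> (?A \<union> ?B)"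
    using AB finite_subset[OF AS fin] finite_subset[OF BS fin] by (intro sum.union_disjoint[symmetric])
  also have "\<dots> \<le> sum \<pi> (Pow P)"
    using AS BS fin Z by (intro sum_mono2) (auto simp: \<pi>_def)
  finally consider "sum \<pi> ?A \<le> 1/2" | "sum \<pi> ?B \<le> 1/2" using one by linarith
  then have "ereal M \<le> ereal_of_enat (mixing_time (Pow P) K \<pi>)"
  proof cases
    case 1
    have "{} \<in> ?A"
      using mean1 \<delta> \<rho>01[of \<theta>\<^sub>1] \<rho>1 by (intro empty_in_lower_well[of \<rho>\<^sub>1]) force+
    show ?thesis
    proof (rule mixing_time_ge_bottleneck[where A = ?A and F = ?FA])
      show "stationary (Pow P) K \<pi>" using st by (simp add: \<pi>_def[abs_def] Z_def)
      show "sum \<pi> ?FA \<le> (real (card P) * exp (\<tau>\<^sup>2 * V - \<tau> * \<delta>)) * sum \<pi> ?A"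
        by (intro scale lower_well_boundary[OF \<rho>1] \<tau> mean1)
      show "0 < sum \<pi> ?A" using \<open>{} \<in> ?A\<close> AS by (intro pos) auto
      fix X Y assume XY: "X \<in> ?A - ?FA" "Y \<in> Pow P - ?A"
      then obtain e where e: "e \<in> P" "discrete_deriv H e Y > \<theta>\<^sub>1" by (auto simp: lower_well_def)
      then have "discrete_deriv H e X < \<theta>\<^sub>1 - \<delta>" using XY by auto
      then show "K X Y = 0" using near(1)[of X Y e] XY e by (force simp: lower_well_def)
    qed (use 1 AS fin mk one Z M in \<open>auto simp: \<pi>_def\<close>)
  next
    case 2
    have "P \<in> ?B"
      using mean2 \<delta> \<rho>01[of \<theta>\<^sub>2] \<rho>2 by (intro full_in_upper_well[of \<rho>\<^sub>2]) force+
    show ?thesis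
    proof (rule mixing_time_ge_bottleneck[where A = ?B and F = ?FB])
      show "stationary (Pow P) K \<pi>" using st by (simp add: \<pi>_def[abs_def] Z_def)
      show "sum \<pi> ?FB \<le> (real (card P) * exp (\<tau>\<^sup>2 * V - \<tau> * \<delta>)) * sum \<pi> ?B"
        by (intro scale upper_well_boundary[OF \<rho>2] \<tau> mean2)
      show "0 < sum \<pi> ?B" using \<open>P \<in> ?B\<close> BS by (intro pos) auto
      fix X Y assume XY: "X \<in> ?B - ?FB" "Y \<in> Pow P - ?B"
      then obtain e where e: "e \<in> P" "discrete_deriv H e Y < \<theta>\<^sub>2" by (auto simp: upper_well_def)
      then have "discrete_deriv H e X > \<theta>\<^sub>2 + \<delta>" using XY by auto
      then show "K X Y = 0" using near(2)[of X Y e] XY e by (force simp: upper_well_def)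
    qed (use 2 BS fin mk one Z M in \<open>auto simp: \<pi>_def\<close>)
  qed
  then show ?thesis by (simp add: \<pi>_def[abs_def] Z_def)
qed

end

subsection \<open>Counting embeddings\<close>

definition embeddings :: "nat \<Rightarrow> nat \<Rightarrow> (nat \<Rightarrow> nat) set" where
  "embeddings m n = {\<sigma> \<in> {1..m} \<rightarrow>\<^sub>E {1..n}. inj_on \<sigma> {1..m}}"

definition edge_embeddings :: "nat \<Rightarrow> nat set set \<Rightarrow> nat \<Rightarrow> nat set \<Rightarrow> (nat \<Rightarrow> nat) set" where
  "edge_embeddings m E n e = {\<sigma> \<in> embeddings m n. e \<in> (`) \<sigma> ` E}"

text \<open>These are the copies through \<open>e\<close> that exist once \<open>e\<close> is
  present, whether or not \<open>X\<close> contains it; the discrete derivative counts exactly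
  these.\<close>

definition edge_copies :: "nat \<Rightarrow> nat set set \<Rightarrow> nat \<Rightarrow> nat set \<Rightarrow> nat set set \<Rightarrow> (nat \<Rightarrow> nat) set" where
  "edge_copies m E n e X = {\<sigma> \<in> edge_embeddings m E n e. (`) \<sigma> ` E \<subseteq> insert e X}"

lemma finite_embeddings [simp]: "finite (embeddings m n)"
  unfolding embeddings_def by (rule finite_subset[of _ "{1..m} \<rightarrow>\<^sub>E {1..n}"]) (auto intro: finite_PiE)

lemma finite_edge_embeddings [simp]: "finite (edge_embeddings m E n e)"
  unfolding edge_embeddings_def by simp

lemma finite_edge_copies [simp]: "finite (edge_copies m E n e X)"
  unfolding edge_copies_def by simp

lemma edge_embeddings_empty [simp]: "edge_embeddings m {} n e = {}"
  by (simp add: edge_embeddings_def)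

lemma pairs_eq: "pairs n = {e. e \<subseteq> {1..n} \<and> card e = 2}"
proof (intro equalityI subsetI)
  fix e assume "e \<in> {e. e \<subseteq> {1..n} \<and> card e = 2}"
  then show "e \<in> pairs n" unfolding pairs_def card_2_iff by blast
qed (auto simp: pairs_def)

lemma finite_pairs [simp]: "finite (pairs n)"
  unfolding pairs_eq by (rule finite_subset[of _ "Pow {1..n}"]) auto

lemma card_pairs: "card (pairs n) = n choose 2"
  unfolding pairs_eq by (subst n_subsets) auto

lemma image_edges_subset_pairs:
  assumes "E \<subseteq> pairs m" "\<sigma> \<in> embeddings m n"
  shows "(`) \<sigma> ` E \<subseteq> pairs n"
proof (intro image_subsetI)
  fix a assume "a \<in> E"
  then have a: "a \<subseteq> {1..m}" "card a = 2" using assms by (auto simp: pairs_eq)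
  then have "card (\<sigma> ` a) = 2"
    using assms inj_on_subset[of \<sigma> "{1..m}" a] by (auto simp: embeddings_def card_image)
  moreover have "\<sigma> ` a \<subseteq> {1..n}" using a assms by (auto simp: embeddings_def PiE_def)
  ultimately show "\<sigma> ` a \<in> pairs n" by (auto simp: pairs_eq)
qed

lemma inj_on_image_edges:
  assumes "E \<subseteq> pairs m" "\<sigma> \<in> embeddings m n"
  shows "inj_on ((`) \<sigma>) E"
proof -
  have "inj_on ((`) \<sigma>) (Pow {1..m})"
    using assms(2) by (intro inj_on_image_Pow) (auto simp: embeddings_def)
  then show ?thesis by (rule inj_on_subset) (use assms(1) in \<open>auto simp: pairs_eq\<close>)
qed

lemma finite_edges: "E \<subseteq> pairs m \<Longrightarrow> finite E"
  by (rule finite_subset) auto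

text \<open>The copies in \<open>insert e X\<close> that avoid \<open>e\<close> are those in
  \<open>X - {e}\<close>; the remaining ones pass through \<open>e\<close>.\<close>

lemma hom_count_diff:
  "real (hom_count m E n (insert e X)) - real (hom_count m E n (X - {e}))
    = real (card (edge_copies m E n e X))"
proof -
  let ?h = "\<lambda>X. {\<sigma> \<in> embeddings m n. (`) \<sigma> ` E \<subseteq> X}"
  have h: "hom_count m E n X = card (?h X)" for X
    unfolding hom_count_def embeddings_def by (intro arg_cong[where f = card]) auto
  have "?h (insert e X) = ?h (X - {e}) \<union> edge_copies m E n e X"
    unfolding edge_copies_def edge_embeddings_def by auto
  moreover have "?h (X - {e}) \<inter> edge_copies m E n e X = {}"
    unfolding edge_copies_def edge_embeddings_def by auto
  ultimately have "card (?h (insert e X)) = card (?h (X - {e})) + card (edge_copies m E n e X)"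
    by (simp add: card_Un_disjoint)
  then show ?thesis by (simp add: h)
qed

lemma discrete_deriv_hamiltonian:
  "discrete_deriv (hamiltonian s m E \<beta> n) e X
    = (\<Sum>i=1..s. \<beta> i * real (card (edge_copies (m i) (E i) n e X)) / (real n powi (int (m i) - 2)))"
  unfolding discrete_deriv_def hamiltonian_def hom_count_diff[symmetric]
  by (simp add: sum_subtractf[symmetric] right_diff_distrib diff_divide_distrib)

lemma edge_copies_mono: "X \<subseteq> Y \<Longrightarrow> edge_copies m E n e X \<subseteq> edge_copies m E n e Y"
  unfolding edge_copies_def by auto

text \<open>A copy through \<open>e\<close> that appears when \<open>a\<close> is added must use
  both pairs. This reduces influences to counting embeddings through two prescribed pairs.\<close>

lemma edge_copies_insert:
  "edge_copies m E n e (insert a X)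
    \<subseteq> edge_copies m E n e X \<union> edge_embeddings m E n e \<inter> edge_embeddings m E n a"
  unfolding edge_copies_def edge_embeddings_def by auto

lemma edge_copies_insert_self: "edge_copies m E n e (insert e X) = edge_copies m E n e X"
  unfolding edge_copies_def by auto

text \<open>With a single edge, the copy needs nothing besides \<open>e\<close>, so its contribution
  to the derivative is constant in \<open>X\<close>. This is why the sign of
  \<open>\<beta> 1\<close> may be arbitrary.\<close>

lemma edge_copies_single: "edge_copies m {b} n e X = edge_embeddings m {b} n e"
  unfolding edge_copies_def edge_embeddings_def by auto

text \<open>An embedding through \<open>e\<close> requires the presence of \<open>card E - 1\<close>
  further pairs, which are distinct because the embedding is injective on edges.\<close>

lemma bernoulli_mean_edge_copies:
  assumes E: "E \<subseteq> pairs m"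
  shows "bernoulli_mean \<rho> (pairs n) (\<lambda>X. real (card (edge_copies m E n e X)))
    = real (card (edge_embeddings m E n e)) * \<rho> ^ (card E - 1)"
proof -
  have "real (card (edge_copies m E n e X))
      = (\<Sum>\<sigma>\<in>edge_embeddings m E n e. if (`) \<sigma> ` E - {e} \<subseteq> X then 1 else 0)" for X
  proof -
    have "edge_copies m E n e X = {\<sigma> \<in> edge_embeddings m E n e. (`) \<sigma> ` E - {e} \<subseteq> X}"
      unfolding edge_copies_def by auto
    then show ?thesis by (simp add: sum.If_cases Int_def)
  qed
  then have "bernoulli_mean \<rho> (pairs n) (\<lambda>X. real (card (edge_copies m E n e X)))
     = (\<Sum>\<sigma>\<in>edge_embeddings m E n e.
          bernoulli_mean \<rho> (pairs n) (\<lambda>X. if (`) \<sigma> ` E - {e} \<subseteq> X then 1 else 0))"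
    by (simp add: bernoulli_mean_sum)
  also have "\<dots> = (\<Sum>\<sigma>\<in>edge_embeddings m E n e. \<rho> ^ (card E - 1))"
  proof (rule sum.cong[OF refl])
    fix \<sigma> assume \<sigma>: "\<sigma> \<in> edge_embeddings m E n e"
    then have \<sigma>': "\<sigma> \<in> embeddings m n" "e \<in> (`) \<sigma> ` E" by (auto simp: edge_embeddings_def)
    have "card ((`) \<sigma> ` E - {e}) = card E - 1"
      using \<sigma>'(2) finite_edges[OF E] card_image[OF inj_on_image_edges[OF E \<sigma>'(1)]]
      by (simp add: card_Diff_singleton)
    then show "bernoulli_mean \<rho> (pairs n) (\<lambda>X. if (`) \<sigma> ` E - {e} \<subseteq> X then 1 else 0) = \<rho> ^ (card E - 1)"
      using image_edges_subset_pairs[OF E \<sigma>'(1)] by (subst bernoulli_mean_superset) auto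
  qed
  finally show ?thesis by simp
qed

section \<open>Embeddings through one or two prescribed pairs\<close>

lemma card_edge_embeddings:
  assumes E: "E \<subseteq> pairs m"
  shows "card (edge_embeddings m E n e) = (\<Sum>b\<in>E. card {\<sigma> \<in> embeddings m n. \<sigma> ` b = e})"
proof -
  have "edge_embeddings m E n e = (\<Union>b\<in>E. {\<sigma> \<in> embeddings m n. \<sigma> ` b = e})"
    unfolding edge_embeddings_def by auto
  moreover have "{\<sigma> \<in> embeddings m n. \<sigma> ` b = e} \<inter> {\<sigma> \<in> embeddings m n. \<sigma> ` d = e} = {}"
    if "b \<in> E" "d \<in> E" "b \<noteq> d" for b d
    using that inj_on_image_edges[OF E] by (auto dest: inj_onD)
  ultimately show ?thesis
    using finite_edges[OF E] by (simp add: card_UN_disjoint)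
qed

lemma card_embeddings_ordered:
  assumes b: "{x, y} \<subseteq> {1..m}" "x \<noteq> y" and e: "{u, v} \<subseteq> {1..n}" "u \<noteq> v"
  shows "card {\<sigma> \<in> embeddings m n. \<sigma> x = u \<and> \<sigma> y = v} \<le> n ^ (m - 2)"
    and "(n - m) ^ (m - 2) \<le> card {\<sigma> \<in> embeddings m n. \<sigma> x = u \<and> \<sigma> y = v}"
proof -
  let ?S = "{\<sigma> \<in> embeddings m n. \<sigma> x = u \<and> \<sigma> y = v}"
  let ?R = "{1..m} - {x, y}" and ?N = "{1..n} - {u, v}"
  let ?T = "{\<tau> \<in> ?R \<rightarrow>\<^sub>E ?N. inj_on \<tau> ?R}"
  have cR: "card ?R = m - 2" and cN: "card ?N = n - 2"
    using b e by (auto simp: card_Diff_subset)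
  \<comment> \<open>Upper bound: an embedding with two prescribed values is determined by its
    restriction to the other \<open>m - 2\<close> vertices.\<close>
  let ?r = "\<lambda>\<sigma>::nat \<Rightarrow> nat. restrict \<sigma> ?R"
  have "inj_on ?r ?S"
  proof (rule inj_onI)
    fix \<sigma> \<sigma>' assume *: "\<sigma> \<in> ?S" "\<sigma>' \<in> ?S" "?r \<sigma> = ?r \<sigma>'"
    show "\<sigma> = \<sigma>'"
    proof (rule PiE_ext)
      show "\<sigma> \<in> {1..m} \<rightarrow>\<^sub>E {1..n}" "\<sigma>' \<in> {1..m} \<rightarrow>\<^sub>E {1..n}" using * by (auto simp: embeddings_def)
      fix i assume i: "i \<in> {1..m}"
      show "\<sigma> i = \<sigma>' i"
      proof (cases "i = x \<or> i = y")
        case False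
        then show ?thesis using i fun_cong[OF *(3), of i] by simp
      qed (use * in auto)
    qed
  qed
  moreover have "?r ` ?S \<subseteq> ?R \<rightarrow>\<^sub>E {1..n}" 
    by (intro image_subsetI PiE_I) (auto simp: embeddings_def PiE_def Pi_def)
  ultimately have "card ?S \<le> card (?R \<rightarrow>\<^sub>E {1..n})"
    by (intro card_inj_on_le) (auto intro: finite_PiE)
  then show "card ?S \<le> n ^ (m - 2)" using cR by (simp add: card_funcsetE)
  \<comment> \<open>Lower bound: every injection of the other vertices into the complement of
    \<open>{u, v}\<close> extends to such an embedding; each successive vertex has at least
    \<open>n - m\<close> choices.\<close>
  let ?g = "\<lambda>\<tau> i. if i = x then u else if i = y then v else (\<tau> i :: nat)"
  have "inj_on ?g ?T"
  proof (rule inj_onI)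
    fix \<tau> \<tau>' assume *: "\<tau> \<in> ?T" "\<tau>' \<in> ?T" "?g \<tau> = ?g \<tau>'"
    show "\<tau> = \<tau>'"
    proof (rule PiE_ext)
      show "\<tau> \<in> ?R \<rightarrow>\<^sub>E ?N" "\<tau>' \<in> ?R \<rightarrow>\<^sub>E ?N" using * by auto
      show "\<tau> i = \<tau>' i" if "i \<in> ?R" for i using that fun_cong[OF *(3), of i] by auto
    qed
  qed
  moreover have "?g ` ?T \<subseteq> ?S"
  proof (intro image_subsetI)
    fix \<tau> assume \<tau>: "\<tau> \<in> ?T"
    have "?g \<tau> \<in> {1..m} \<rightarrow>\<^sub>E {1..n}"
    proof (rule PiE_I)
      fix i assume "i \<in> {1..m}"
      then show "?g \<tau> i \<in> {1..n}" using \<tau> e by (auto simp: PiE_def Pi_def)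
    next
      fix i assume i: "i \<notin> {1..m}"
      then have "i \<noteq> x" "i \<noteq> y" "i \<notin> ?R" using b by auto
      then show "?g \<tau> i = undefined" using \<tau> by (auto simp: PiE_def extensional_def)
    qed
    moreover have "inj_on (?g \<tau>) {1..m}"
    proof (rule inj_onI)
      fix i j assume ij: "i \<in> {1..m}" "j \<in> {1..m}" "?g \<tau> i = ?g \<tau> j"
      have ne: "\<tau> k \<noteq> u \<and> \<tau> k \<noteq> v" "?g \<tau> k = \<tau> k" if "k \<in> ?R" for k
        using \<tau> that by (auto simp: PiE_def Pi_def)
      have ends: "k = x \<and> ?g \<tau> k = u \<or> k = y \<and> ?g \<tau> k = v" if "k \<in> {1..m} - ?R" for k
        using that b by auto
      consider "i \<in> ?R" "j \<in> ?R" | "i \<in> ?R" "j \<in> {1..m} - ?R"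
        | "i \<in> {1..m} - ?R" "j \<in> ?R" | "i \<in> {1..m} - ?R" "j \<in> {1..m} - ?R"
        using ij(1,2) by blast
      then show "i = j"
      proof cases
        case 1
        then show ?thesis using \<tau> inj_onD[of \<tau> ?R i j] ij(3) ne(2) by simp
      next
        case 2
        then show ?thesis using ne[of i] ends[of j] ij(3) by metis
      next
        case 3
        then show ?thesis using ne[of j] ends[of i] ij(3) by metis
      next
        case 4
        then show ?thesis using ends[of i] ends[of j] ij(3) e(2) by metis
      qed
    qed
    ultimately show "?g \<tau> \<in> ?S" using b by (auto simp: embeddings_def)
  qed
  ultimately have "card ?T \<le> card ?S" by (intro card_inj_on_le) auto
  moreover have "card ?T = (\<Prod>j = 0..<m - 2. n - 2 - j)"
    using card_inj_on_subset_funcset[of ?R ?N ?R] unfolding cR cN by simp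
  moreover have "(\<Prod>j = 0..<m - 2. n - m) \<le> (\<Prod>j = 0..<m - 2. n - 2 - j)"
    by (rule prod_mono) auto
  ultimately show "(n - m) ^ (m - 2) \<le> card ?S" by simp
qed

text \<open>An edge can be mapped onto \<open>e\<close> in two orientations; this is the origin of
  the factor 2 in \<open>Psi\<close>.\<close>

lemma card_embeddings_edge:
  assumes "b \<in> pairs m" "e \<in> pairs n"
  shows "card {\<sigma> \<in> embeddings m n. \<sigma> ` b = e} \<le> 2 * n ^ (m - 2)"
    and "2 * (n - m) ^ (m - 2) \<le> card {\<sigma> \<in> embeddings m n. \<sigma> ` b = e}"
proof -
  obtain x y where b: "b = {x, y}" "{x, y} \<subseteq> {1..m}" "x \<noteq> y"
    using assms(1) by (auto simp: pairs_def)
  obtain u v where e: "e = {u, v}" "{u, v} \<subseteq> {1..n}" "u \<noteq> v"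
    using assms(2) by (auto simp: pairs_def)
  let ?S = "\<lambda>u v. {\<sigma> \<in> embeddings m n. \<sigma> x = u \<and> \<sigma> y = v}"
  have "{\<sigma> \<in> embeddings m n. \<sigma> ` b = e} = ?S u v \<union> ?S v u"
    unfolding b(1) e(1) by (auto simp: doubleton_eq_iff)
  moreover have "?S u v \<inter> ?S v u = {}" using e(3) by auto
  ultimately have "card {\<sigma> \<in> embeddings m n. \<sigma> ` b = e} = card (?S u v) + card (?S v u)"
    by (simp add: card_Un_disjoint)
  then show "card {\<sigma> \<in> embeddings m n. \<sigma> ` b = e} \<le> 2 * n ^ (m - 2)"
    "2 * (n - m) ^ (m - 2) \<le> card {\<sigma> \<in> embeddings m n. \<sigma> ` b = e}"
    using card_embeddings_ordered[OF b(2,3) e(2,3)] card_embeddings_ordered[OF b(2,3), of v u n] e(2,3)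
    by auto
qed

lemma card_edge_embeddings_bounds:
  assumes E: "E \<subseteq> pairs m" and e: "e \<in> pairs n"
  shows "card (edge_embeddings m E n e) \<le> 2 * card E * n ^ (m - 2)"
    and "2 * card E * (n - m) ^ (m - 2) \<le> card (edge_embeddings m E n e)"
proof -
  have "(\<Sum>b\<in>E. card {\<sigma> \<in> embeddings m n. \<sigma> ` b = e}) \<le> (\<Sum>b\<in>E. 2 * n ^ (m - 2))"
    using card_embeddings_edge(1) E e by (intro sum_mono) auto
  then show "card (edge_embeddings m E n e) \<le> 2 * card E * n ^ (m - 2)"
    by (simp add: card_edge_embeddings[OF E] mult_ac)
  have "(\<Sum>b\<in>E. 2 * (n - m) ^ (m - 2)) \<le> (\<Sum>b\<in>E. card {\<sigma> \<in> embeddings m n. \<sigma> ` b = e})"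
    using card_embeddings_edge(2) E e by (intro sum_mono) auto
  then show "2 * card E * (n - m) ^ (m - 2) \<le> card (edge_embeddings m E n e)"
    by (simp add: card_edge_embeddings[OF E] mult_ac)
qed

lemma pairs_vertices_ge_two: "E \<subseteq> pairs m \<Longrightarrow> E \<noteq> {} \<Longrightarrow> 2 \<le> m"
proof -
  assume "E \<subseteq> pairs m" "E \<noteq> {}"
  then obtain b where "b \<subseteq> {1..m}" "card b = 2" by (auto simp: pairs_eq)
  then show ?thesis using card_mono[of "{1..m}" b] by simp
qed

lemma powi_vertices:
  assumes "E \<subseteq> pairs m" "E \<noteq> {}"
  shows "real n powi (int m - 2) = real n ^ (m - 2)"
proof -
  have "int m - 2 = int (m - 2)" using pairs_vertices_ge_two[OF assms] by simp
  then show ?thesis by (metis power_int_of_nat)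
qed

lemma edge_embeddings_density_bounds:
  assumes E: "E \<subseteq> pairs m" and e: "e \<in> pairs n" and n: "m \<le> n" "0 < n"
  shows "real (card (edge_embeddings m E n e)) / (real n powi (int m - 2)) \<le> 2 * real (card E)"
    and "2 * real (card E) * (1 - real m / real n) ^ (m - 2)
      \<le> real (card (edge_embeddings m E n e)) / (real n powi (int m - 2))"
proof -
  have "real (card (edge_embeddings m E n e)) / (real n powi (int m - 2)) \<le> 2 * real (card E) \<and>
      2 * real (card E) * (1 - real m / real n) ^ (m - 2)
      \<le> real (card (edge_embeddings m E n e)) / (real n powi (int m - 2))"
  \<comment> \<open>An edge forces \<open>2 \<le> m\<close> and makes the exponent a natural number;
    without edges all quantities compared are zero.\<close>
  proof (cases "E = {}")
    case False
    have "real (card (edge_embeddings m E n e)) \<le> real (2 * card E * n ^ (m - 2))"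
      using card_edge_embeddings_bounds(1)[OF E e] of_nat_le_iff by blast
    moreover have "real (2 * card E * (n - m) ^ (m - 2)) \<le> real (card (edge_embeddings m E n e))"
      using card_edge_embeddings_bounds(2)[OF E e] of_nat_le_iff by blast
    moreover have "(1 - real m / real n) ^ (m - 2) = (real (n - m)) ^ (m - 2) / real n ^ (m - 2)"
      using n by (simp add: of_nat_diff diff_divide_distrib flip: power_divide)
    ultimately show ?thesis
      unfolding powi_vertices[OF E False] using n by (simp add: field_simps)
  qed simp
  then show "real (card (edge_embeddings m E n e)) / (real n powi (int m - 2)) \<le> 2 * real (card E)"
    "2 * real (card E) * (1 - real m / real n) ^ (m - 2)
      \<le> real (card (edge_embeddings m E n e)) / (real n powi (int m - 2))" by auto
qed

text \<open>Two distinct edges span at least three vertices, which are mapped into the at most four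
  vertices of \<open>e \<union> a\<close>.\<close>

lemma card_embeddings_two_edges:
  assumes b: "b \<in> pairs m" "d \<in> pairs m" "b \<noteq> d" and e: "e \<in> pairs n" "a \<in> pairs n"
  shows "3 \<le> m" "card {\<sigma> \<in> embeddings m n. \<sigma> ` b = e \<and> \<sigma> ` d = a} \<le> 64 * n ^ (m - 3)"
proof -
  have fin: "finite b" "finite d" "card b = 2" "card d = 2" "b \<subseteq> {1..m}" "d \<subseteq> {1..m}"
    using b by (auto simp: pairs_eq intro: finite_subset)
  have "\<not> d \<subseteq> b" using fin b(3) card_subset_eq[of b d] by auto
  then obtain v where v: "v \<in> d" "v \<notin> b" by auto
  let ?U = "insert v b"
  have U: "card ?U = 3" "?U \<subseteq> {1..m}" using v fin by auto
  then show "3 \<le> m" using card_mono[of "{1..m}" ?U] by simp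
  have ea: "card (e \<union> a) \<le> 4"
    using card_Un_le[of e a] e by (auto simp: pairs_eq)
  \<comment> \<open>Relaxing injectivity, the three vertices in \<open>?U\<close> have at most four
    values each, giving \<open>64 = 4 ^ 3\<close>, and each other vertex has
    \<open>n\<close>.\<close>
  let ?T = "PiE {1..m} (\<lambda>i. if i \<in> ?U then e \<union> a else {1..n})"
  have finT: "finite ?T"
    using e by (intro finite_PiE) (auto simp: pairs_eq intro: finite_subset)
  have "{\<sigma> \<in> embeddings m n. \<sigma> ` b = e \<and> \<sigma> ` d = a} \<subseteq> ?T"
    using v by (auto simp: embeddings_def PiE_def Pi_def)
  then have "card {\<sigma> \<in> embeddings m n. \<sigma> ` b = e \<and> \<sigma> ` d = a} \<le> card ?T"
    by (rule card_mono[OF finT])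
  also have "card ?T = (\<Prod>i\<in>{1..m}. card (if i \<in> ?U then e \<union> a else {1..n}))"
    by (simp add: card_PiE)
  also have "\<dots> = (\<Prod>i\<in>?U. card (e \<union> a)) * (\<Prod>i\<in>{1..m} - ?U. n)"
    using U(2) by (subst prod.subset_diff[of ?U]) (auto simp: mult.commute intro!: arg_cong2[where f = "(*)"] prod.cong)
  also have "\<dots> = card (e \<union> a) ^ 3 * n ^ (m - 3)"
    using U fin by (simp only: prod_constant card_Diff_subset finite_insert) simp
  also have "\<dots> \<le> 4 ^ 3 * n ^ (m - 3)"
    using ea by (intro mult_right_mono power_mono) auto
  finally show "card {\<sigma> \<in> embeddings m n. \<sigma> ` b = e \<and> \<sigma> ` d = a} \<le> 64 * n ^ (m - 3)" by simp
qed

lemma two_edge_embeddings_density_le: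
  assumes E: "E \<subseteq> pairs m" and e: "e \<in> pairs n" "a \<in> pairs n" "e \<noteq> a" and n: "0 < n"
  shows "real (card (edge_embeddings m E n e \<inter> edge_embeddings m E n a)) / (real n powi (int m - 2))
    \<le> 64 * (real (card E))\<^sup>2 / real n"
proof (cases "edge_embeddings m E n e \<inter> edge_embeddings m E n a = {}")
  case False
  let ?I = "{(b, d). b \<in> E \<and> d \<in> E \<and> b \<noteq> d}"
  let ?S = "\<lambda>(b, d). {\<sigma> \<in> embeddings m n. \<sigma> ` b = e \<and> \<sigma> ` d = a}"
  have finE: "finite E" by (rule finite_edges[OF E])
  have I: "?I \<subseteq> E \<times> E" by auto
  have finI: "finite ?I" by (rule finite_subset[OF I]) (use finE in auto)
  have un: "edge_embeddings m E n e \<inter> edge_embeddings m E n a = (\<Union>p\<in>?I. ?S p)"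
  proof (intro equalityI subsetI)
    fix \<sigma> assume "\<sigma> \<in> edge_embeddings m E n e \<inter> edge_embeddings m E n a"
    then obtain b d where "\<sigma> \<in> embeddings m n" "b \<in> E" "d \<in> E" "\<sigma> ` b = e" "\<sigma> ` d = a"
      by (auto simp: edge_embeddings_def)
    with e(3) show "\<sigma> \<in> (\<Union>p\<in>?I. ?S p)" by (intro UN_I[of "(b, d)"]) auto
  qed (auto simp: edge_embeddings_def)
  \<comment> \<open>A nonempty intersection forces \<open>3 \<le> m\<close>, so
    \<open>n ^ (m - 3)\<close> is truly smaller than \<open>n ^ (m - 2)\<close> by a factor
    \<open>n\<close>, without truncated subtraction.\<close>
  with False obtain p where "p \<in> ?I" by auto
  then have m: "3 \<le> m" and E0: "E \<noteq> {}" using card_embeddings_two_edges(1)[OF _ _ _ e(1,2)] E by auto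
  have "card (\<Union>p\<in>?I. ?S p) \<le> (\<Sum>p\<in>?I. card (?S p))" by (rule card_UN_le[OF finI])
  also have "\<dots> \<le> (\<Sum>p\<in>?I. 64 * n ^ (m - 3))"
    using card_embeddings_two_edges(2)[OF _ _ _ e(1,2)] E by (intro sum_mono) auto
  also have "\<dots> \<le> (card E)\<^sup>2 * (64 * n ^ (m - 3))"
    using card_mono[OF _ I] finE by (simp add: card_cartesian_product power2_eq_square)
  finally have "real (card (edge_embeddings m E n e \<inter> edge_embeddings m E n a))
      \<le> real ((card E)\<^sup>2 * (64 * n ^ (m - 3)))"
    unfolding un of_nat_le_iff .
  moreover have "m - 2 = Suc (m - 3)" using m by simp
  ultimately show ?thesis
    unfolding powi_vertices[OF E E0] using n by (simp add: field_simps)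
qed (use n in simp)

text \<open>Double counting: each embedding through \<open>e\<close> passes through at most
  \<open>card E\<close> pairs. Summing the bounds for single pairs would only give order
  \<open>n\<close>, relative to the normalisation.\<close>

lemma sum_two_edge_embeddings_le:
  assumes E: "E \<subseteq> pairs m" and e: "e \<in> pairs n"
  shows "(\<Sum>a\<in>pairs n. card (edge_embeddings m E n e \<inter> edge_embeddings m E n a))
    \<le> card E * card (edge_embeddings m E n e)"
proof -
  let ?F = "edge_embeddings m E n e"
  have "(\<Sum>a\<in>pairs n. card (?F \<inter> edge_embeddings m E n a))
      = (\<Sum>a\<in>pairs n. \<Sum>\<sigma>\<in>?F. if \<sigma> \<in> edge_embeddings m E n a then 1 else 0)"
    by (simp add: sum.If_cases)
  also have "\<dots> = (\<Sum>\<sigma>\<in>?F. \<Sum>a\<in>pairs n. if \<sigma> \<in> edge_embeddings m E n a then 1 else 0)"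
    by (rule sum.swap)
  also have "\<dots> \<le> (\<Sum>\<sigma>\<in>?F. card E)"
  proof (rule sum_mono)
    fix \<sigma> assume "\<sigma> \<in> ?F"
    have "(\<Sum>a\<in>pairs n. if \<sigma> \<in> edge_embeddings m E n a then 1 else 0)
        = card (pairs n \<inter> {a. \<sigma> \<in> edge_embeddings m E n a})"
      by (simp add: sum.If_cases)
    also have "\<dots> \<le> card ((`) \<sigma> ` E)"
      using finite_edges[OF E] by (intro card_mono) (auto simp: edge_embeddings_def)
    also have "\<dots> \<le> card E" by (rule card_image_le[OF finite_edges[OF E]])
    finally show "(\<Sum>a\<in>pairs n. if \<sigma> \<in> edge_embeddings m E n a then 1 else 0) \<le> card E" .
  qed
  finally show ?thesis by (simp add: mult.commute)
qed

subsection \<open>Glauber dynamics\<close>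

context
  fixes s :: nat and m :: "nat \<Rightarrow> nat" and E :: "nat \<Rightarrow> nat set set" and \<beta> :: "nat \<Rightarrow> real" and n :: nat
begin

lemma sum_exp_hamiltonian_pos: "0 < (\<Sum>Y\<in>graphs n. exp (hamiltonian s m E \<beta> n Y))"
  by (rule sum_pos) (auto simp: graphs_def)

text \<open>\<open>2 \<le> n\<close> makes the number of pairs positive, so that dividing by it
  normalises the rows.\<close>

lemma markov_kernel_glauber:
  assumes "2 \<le> n"
  shows "markov_kernel (graphs n) (glauber s m E \<beta> n)"
  unfolding markov_kernel_def
proof (intro conjI ballI)
  fix X Y assume "X \<in> graphs n" "Y \<in> graphs n"
  show "0 \<le> glauber s m E \<beta> n X Y"
    unfolding glauber_def Let_def
    by (intro divide_nonneg_nonneg sum_nonneg add_nonneg_nonneg)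
      (auto simp: field_simps add_pos_pos intro: order_less_imp_le)
next
  fix X assume X: "X \<in> graphs n"
  define q where "q e = (let d = hamiltonian s m E \<beta> n (insert e X) - hamiltonian s m E \<beta> n (X - {e})
    in exp d / (1 + exp d))" for e
  have fin: "finite (graphs n)" by (simp add: graphs_def)
  have "(\<Sum>Y\<in>graphs n. glauber s m E \<beta> n X Y)
      = (\<Sum>e\<in>pairs n. \<Sum>Y\<in>graphs n. (if Y = insert e X then q e else 0) + (if Y = X - {e} then 1 - q e else 0))
        / real (n choose 2)"
    unfolding glauber_def q_def Let_def sum_divide_distrib[symmetric] by (subst sum.swap) simp
  also have "(\<Sum>e\<in>pairs n. \<Sum>Y\<in>graphs n. (if Y = insert e X then q e else 0) + (if Y = X - {e} then 1 - q e else 0))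
      = (\<Sum>e\<in>pairs n. 1)"
  proof (rule sum.cong[OF refl])
    fix e assume "e \<in> pairs n"
    then have "insert e X \<in> graphs n" "X - {e} \<in> graphs n" using X by (auto simp: graphs_def)
    then show "(\<Sum>Y\<in>graphs n. (if Y = insert e X then q e else 0) + (if Y = X - {e} then 1 - q e else 0)) = 1"
      using fin by (simp add: sum.distrib)
  qed
  also have "\<dots> / real (n choose 2) = 1"
    using assms by (simp add: card_pairs)
  finally show "(\<Sum>Y\<in>graphs n. glauber s m E \<beta> n X Y) = 1" .
qed

text \<open>The update of each fixed pair already preserves the Gibbs weights: only the two states
  that agree with \<open>Y\<close> off \<open>e\<close> can move to \<open>Y\<close>, and both do so
  with the conditional probability of the state of \<open>e\<close> in \<open>Y\<close>.\<close>

lemma stationary_glauber: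
  assumes "2 \<le> n"
  shows "stationary (graphs n) (glauber s m E \<beta> n) (gibbs s m E \<beta> n)"
  unfolding stationary_def
proof
  fix Y assume Y: "Y \<in> graphs n"
  let ?H = "hamiltonian s m E \<beta> n"
  define Z where "Z = (\<Sum>Y\<in>graphs n. exp (?H Y))"
  define q where "q e X = exp (?H (insert e X) - ?H (X - {e})) / (1 + exp (?H (insert e X) - ?H (X - {e})))" for e X
  define g where "g e X = (if Y = insert e X then q e X else 0) + (if Y = X - {e} then 1 - q e X else 0)" for e X
  have Z: "Z > 0" unfolding Z_def by (rule sum_exp_hamiltonian_pos)
  have fin: "finite (graphs n)" by (simp add: graphs_def)
  have step: "(\<Sum>X\<in>graphs n. exp (?H X) * g e X) = exp (?H Y)" if e: "e \<in> pairs n" for e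
  proof -
    let ?p = "insert e Y" and ?m = "Y - {e}"
    have sub: "{?p, ?m} \<subseteq> graphs n" using e Y by (auto simp: graphs_def)
    have "(\<Sum>X\<in>graphs n. exp (?H X) * g e X) = (\<Sum>X\<in>{?p, ?m}. exp (?H X) * g e X)"
    proof (rule sum.mono_neutral_right[OF fin sub], rule ballI)
      fix X assume "X \<in> graphs n - {?p, ?m}"
      then have "Y \<noteq> insert e X" "Y \<noteq> X - {e}" by auto
      then show "exp (?H X) * g e X = 0" by (simp add: g_def)
    qed
    also have "\<dots> = exp (?H ?p) * g e ?p + exp (?H ?m) * g e ?m"
      by (subst sum.insert) auto
    also have "\<dots> = exp (?H Y)"
    proof -
      define r where "r = exp (?H ?p - ?H ?m)"
      have r: "exp (?H ?p) = r * exp (?H ?m)" "1 + r > 0"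
        unfolding r_def by (auto simp: add_pos_pos simp flip: exp_add)
      have qq: "q e ?p = r / (1 + r)" "q e ?m = r / (1 + r)" by (auto simp: q_def r_def)
      have flip: "insert e ?p = ?p" "insert e ?m = ?p" "?p - {e} = ?m" "?m - {e} = ?m" by auto
      have alg1: "r * h * x + h * x = r * h" if "x * (1 + r) = r" for x h :: real
      proof -
        have "r * h * x + h * x = h * (x * (1 + r))" by (simp add: algebra_simps)
        then show ?thesis by (simp only: that mult.commute)
      qed
      have alg2: "r * h * (1 - x) + h * (1 - x) = h" if "x * (1 + r) = r" for x h :: real
      proof -
        have "r * h * (1 - x) + h * (1 - x) = r * h + h - (r * h * x + h * x)" by (simp add: algebra_simps)
        then show ?thesis by (simp only: alg1[OF that] add_diff_cancel_left')
      qed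
      have "r / (1 + r) * (1 + r) = r" using r(2) by simp
      note bal = alg1[OF this, of "exp (?H ?m)", folded r(1)] alg2[OF this, of "exp (?H ?m)", folded r(1)]
      show ?thesis
      proof (cases "e \<in> Y")
        case True
        then have Y: "g e ?p = r / (1 + r)" "g e ?m = r / (1 + r)" "?p = Y"
          unfolding g_def flip qq by auto
        show ?thesis using bal(1) unfolding Y(1,2) by (simp only: Y(3))
      next
        case False
        then have Y: "g e ?p = 1 - r / (1 + r)" "g e ?m = 1 - r / (1 + r)" "?m = Y"
          unfolding g_def flip qq by auto
        show ?thesis using bal(2) unfolding Y(1,2) by (simp only: Y(3))
      qed
    qed
    finally show ?thesis .
  qed
  have "(\<Sum>X\<in>graphs n. gibbs s m E \<beta> n X * glauber s m E \<beta> n X Y)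
      = (\<Sum>X\<in>graphs n. \<Sum>e\<in>pairs n. exp (?H X) * g e X / (Z * real (n choose 2)))"
    unfolding gibbs_def glauber_def Let_def Z_def[symmetric] g_def q_def
    by (simp add: sum_distrib_left sum_divide_distrib)
  also have "\<dots> = (\<Sum>e\<in>pairs n. \<Sum>X\<in>graphs n. exp (?H X) * g e X / (Z * real (n choose 2)))"
    by (rule sum.swap)
  also have "\<dots> = (\<Sum>e\<in>pairs n. exp (?H Y) / (Z * real (n choose 2)))"
    by (simp add: step flip: sum_divide_distrib)
  also have "\<dots> = gibbs s m E \<beta> n Y"
    using assms Z by (simp add: gibbs_def Z_def[symmetric] card_pairs)
  finally show "(\<Sum>X\<in>graphs n. gibbs s m E \<beta> n X * glauber s m E \<beta> n X Y) = gibbs s m E \<beta> n Y" .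
qed

lemma local_chain_glauber: "local_chain (graphs n) (glauber s m E \<beta> n) 1"
  unfolding local_chain_def
proof (intro ballI impI)
  fix X Y assume "glauber s m E \<beta> n X Y > 0"
  then have "\<exists>e. Y = insert e X \<or> Y = X - {e}"
    by (rule contrapos_pp) (simp add: glauber_def)
  then obtain e where "X - Y \<union> (Y - X) \<subseteq> {e}" by blast
  then have "card (X - Y \<union> (Y - X)) \<le> card {e}" by (intro card_mono) auto
  then show "real (card (X - Y \<union> (Y - X))) \<le> 1" by simp
qed

end

subsection \<open>Exponential random graphs at low temperature\<close>

lemma Psi_eq: "Psi s E \<beta> p = (\<Sum>i=1..s. 2 * \<beta> i * real (card (E i)) * p ^ (card (E i) - 1))"
  unfolding Psi_def
proof (rule sum.cong[OF refl])
  fix i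
  show "2 * \<beta> i * real (card (E i)) * p powi (int (card (E i)) - 1)
      = 2 * \<beta> i * real (card (E i)) * p ^ (card (E i) - 1)"
  \<comment> \<open>For an edgeless graph the integer exponent is \<open>-1\<close> and the
    truncated one is \<open>0\<close>, but the coefficient vanishes.\<close>
  proof (cases "card (E i)")
    case (Suc k)
    then show ?thesis by simp
  qed simp
qed

text \<open>Ensures that \<open>deriv\<close> in the low temperature condition is a genuine
  derivative.\<close>

lemma phi_differentiable: "\<exists>D. (phi s E \<beta> has_real_derivative D) (at p)"
proof -
  have "\<exists>D. (Psi s E \<beta> has_real_derivative D) (at p)"
    unfolding Psi_eq[abs_def] by (rule exI) (auto intro!: derivative_eq_intros)
  then obtain D where D: "(Psi s E \<beta> has_real_derivative D) (at p)" by blast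
  have "1 + exp (Psi s E \<beta> p) \<noteq> 0" by (metis add_pos_pos exp_gt_zero less_irrefl zero_less_one)
  then have "(phi s E \<beta> has_real_derivative
      (exp (Psi s E \<beta> p) * D * (1 + exp (Psi s E \<beta> p)) - exp (Psi s E \<beta> p) * (exp (Psi s E \<beta> p) * D))
        / ((1 + exp (Psi s E \<beta> p)) * (1 + exp (Psi s E \<beta> p)))) (at p)"
    unfolding phi_def[abs_def] by (auto intro!: derivative_eq_intros D)
  then show ?thesis by blast
qed

text \<open>The function \<open>phi s E \<beta> x - x\<close> vanishes at \<open>p\<close> with
  negative slope, hence is negative just to the right of \<open>p\<close>.\<close>

lemma stable_fixed_point_right:
  assumes "phi s E \<beta> p = p" "deriv (phi s E \<beta>) p < 1"
  obtains d where "d > 0" "\<And>h. \<lbrakk>0 < h; h < d\<rbrakk> \<Longrightarrow> phi s E \<beta> (p + h) < p + h"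
proof -
  obtain D where D: "(phi s E \<beta> has_real_derivative D) (at p)" using phi_differentiable by blast
  then have "D < 1" using assms(2) DERIV_imp_deriv by metis
  moreover have "((\<lambda>x. phi s E \<beta> x - x) has_real_derivative D - 1) (at p)"
    by (intro derivative_intros D)
  ultimately obtain d where d: "d > 0" "\<forall>h>0. h < d \<longrightarrow> phi s E \<beta> p - p > phi s E \<beta> (p + h) - (p + h)"
    using DERIV_neg_dec_right[of "\<lambda>x. phi s E \<beta> x - x" "D - 1" p] by auto
  then show thesis using that assms(1) by auto
qed

lemma stable_fixed_point_left:
  assumes "phi s E \<beta> p = p" "deriv (phi s E \<beta>) p < 1"
  obtains d where "d > 0" "\<And>h. \<lbrakk>0 < h; h < d\<rbrakk> \<Longrightarrow> p - h < phi s E \<beta> (p - h)"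
proof -
  obtain D where D: "(phi s E \<beta> has_real_derivative D) (at p)" using phi_differentiable by blast
  then have "D < 1" using assms(2) DERIV_imp_deriv by metis
  moreover have "((\<lambda>x. phi s E \<beta> x - x) has_real_derivative D - 1) (at p)"
    by (intro derivative_intros D)
  ultimately obtain d where d: "d > 0" "\<forall>h>0. h < d \<longrightarrow> phi s E \<beta> p - p < phi s E \<beta> (p - h) - (p - h)"
    using DERIV_neg_dec_left[of "\<lambda>x. phi s E \<beta> x - x" "D - 1" p] by auto
  then show thesis using that assms(1) by auto
qed

lemma phi_bounds: "0 < phi s E \<beta> p" "phi s E \<beta> p < 1"
  unfolding phi_def by (auto simp: field_simps add_pos_pos)

lemma low_temperature_wells:
  assumes "low_temperature s E \<beta>"
  obtains u v where "0 < u" "u < v" "phi s E \<beta> u < u" "v < phi s E \<beta> v"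
proof -
  obtain p q where pq: "p < q" "phi s E \<beta> p = p" "phi s E \<beta> q = q"
    "deriv (phi s E \<beta>) p < 1" "deriv (phi s E \<beta>) q < 1"
    using assms unfolding low_temperature_def by (metis linorder_neqE_linordered_idom)
  obtain d where d: "d > 0" "\<And>h. \<lbrakk>0 < h; h < d\<rbrakk> \<Longrightarrow> phi s E \<beta> (p + h) < p + h"
    using stable_fixed_point_right[OF pq(2,4)] by blast
  obtain d' where d': "d' > 0" "\<And>h. \<lbrakk>0 < h; h < d'\<rbrakk> \<Longrightarrow> q - h < phi s E \<beta> (q - h)"
    using stable_fixed_point_left[OF pq(3,5)] by blast
  \<comment> \<open>The wells are located slightly inside the interval between the two fixed points;
    dividing by 3 keeps \<open>p + h\<close> below \<open>q - h\<close>.\<close>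
  define h where "h = min (min d d') (q - p) / 3"
  have h: "0 < h" "h < d" "h < d'" "p + h < q - h"
    using d(1) d'(1) pq(1) unfolding h_def by (auto simp: min_def field_simps)
  have "0 < p" using pq(2) phi_bounds(1)[of s E \<beta> p] by simp
  then show thesis using that[of "p + h" "q - h"] h d(2) d'(2) by auto
qed

section \<open>Influences and means for the exponential random graph Hamiltonian\<close>

locale ergm =
  fixes s :: nat and m :: "nat \<Rightarrow> nat" and E :: "nat \<Rightarrow> nat set set" and \<beta> :: "nat \<Rightarrow> real"
  assumes E1: "E 1 = {{1, 2}}"
    and simple: "i \<in> {1..s} \<Longrightarrow> E i \<subseteq> pairs (m i)"
    and \<beta>_pos: "i \<in> {2..s} \<Longrightarrow> 0 < \<beta> i"
begin

lemma Psi_term_mono: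
  assumes "i \<in> {1..s}" "0 \<le> x" "x \<le> y"
  shows "2 * \<beta> i * real (card (E i)) * x ^ (card (E i) - 1) \<le> 2 * \<beta> i * real (card (E i)) * y ^ (card (E i) - 1)"
proof (cases "i = 1")
  case False
  then show ?thesis using assms \<beta>_pos[of i] by (intro mult_left_mono power_mono) auto
qed (use E1 in simp)

text \<open>If \<open>Psi\<close> is not constant, some graph has at least two edges. It is not the
  single edge, so its coefficient is positive and its term strictly increasing.\<close>

lemma Psi_strict_mono:
  assumes "Psi s E \<beta> p \<noteq> Psi s E \<beta> q" "0 \<le> x" "x < y"
  shows "Psi s E \<beta> x < Psi s E \<beta> y"
proof -
  have "\<exists>i\<in>{1..s}. 2 \<le> card (E i)"
  proof (rule ccontr)
    assume "\<not> (\<exists>i\<in>{1..s}. 2 \<le> card (E i))"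
    then have "card (E i) - 1 = 0" if "i \<in> {1..s}" for i using that by force
    then have "Psi s E \<beta> p = Psi s E \<beta> q" unfolding Psi_eq by simp
    with assms show False by simp
  qed
  then obtain i where i: "i \<in> {1..s}" "2 \<le> card (E i)" by blast
  then have "i \<noteq> 1" using E1 by auto
  then have "\<beta> i > 0" using i \<beta>_pos by auto
  moreover have "x ^ (card (E i) - 1) < y ^ (card (E i) - 1)"
    using i assms by (intro power_strict_mono) auto
  ultimately have "2 * \<beta> i * real (card (E i)) * x ^ (card (E i) - 1) < 2 * \<beta> i * real (card (E i)) * y ^ (card (E i) - 1)"
    using i by (intro mult_strict_left_mono) auto
  then show ?thesis
    unfolding Psi_eq using i assms Psi_term_mono by (intro sum_strict_mono_ex1) auto
qed

text \<open>\<open>C\<^sub>1 / n\<close> bounds each single influence through the two-pair count,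
  and \<open>C\<^sub>2\<close> bounds the total influence through double counting.\<close>

definition C\<^sub>1 :: real where "C\<^sub>1 = (\<Sum>i=1..s. \<bar>\<beta> i\<bar> * (64 * (real (card (E i)))\<^sup>2))"
definition C\<^sub>2 :: real where "C\<^sub>2 = (\<Sum>i=1..s. \<bar>\<beta> i\<bar> * (real (card (E i)) * (2 * real (card (E i)))))"

text \<open>The value at \<open>a = e\<close> is zero because the derivative at \<open>e\<close>
  ignores the state of \<open>e\<close>.\<close>

definition influence :: "nat \<Rightarrow> nat set \<Rightarrow> nat set \<Rightarrow> real" where
  "influence n e a = (if a = e then 0 else \<Sum>i=1..s. \<bar>\<beta> i\<bar> *
     (real (card (edge_embeddings (m i) (E i) n e \<inter> edge_embeddings (m i) (E i) n a)) / (real n powi (int (m i) - 2))))"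

lemma C_nonneg: "0 \<le> C\<^sub>1" "0 \<le> C\<^sub>2"
  unfolding C\<^sub>1_def C\<^sub>2_def by (auto intro!: sum_nonneg)

lemma influence_nonneg: "0 \<le> influence n e a"
  unfolding influence_def by (auto intro!: sum_nonneg mult_nonneg_nonneg divide_nonneg_nonneg)

lemma influence_le:
  assumes "0 < n" "e \<in> pairs n" "a \<in> pairs n"
  shows "influence n e a \<le> C\<^sub>1 / real n"
proof (cases "a = e")
  case False
  have "(\<Sum>i=1..s. \<bar>\<beta> i\<bar> *
        (real (card (edge_embeddings (m i) (E i) n e \<inter> edge_embeddings (m i) (E i) n a)) / (real n powi (int (m i) - 2))))
      \<le> (\<Sum>i=1..s. \<bar>\<beta> i\<bar> * (64 * (real (card (E i)))\<^sup>2 / real n))"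
    using simple assms False by (intro sum_mono mult_left_mono two_edge_embeddings_density_le) auto
  then have "influence n e a \<le> (\<Sum>i=1..s. \<bar>\<beta> i\<bar> * (64 * (real (card (E i)))\<^sup>2 / real n))"
    using False by (simp add: influence_def)
  then show ?thesis by (simp add: C\<^sub>1_def sum_divide_distrib)
qed (use C_nonneg in \<open>simp add: influence_def\<close>)

lemma sum_influence_le:
  assumes n: "0 < n" "\<And>i. i \<in> {1..s} \<Longrightarrow> m i \<le> n" and e: "e \<in> pairs n"
  shows "(\<Sum>a\<in>pairs n. influence n e a) \<le> C\<^sub>2"
proof -
  let ?N = "\<lambda>i a. real (card (edge_embeddings (m i) (E i) n e \<inter> edge_embeddings (m i) (E i) n a))"
  let ?w = "\<lambda>i. real n powi (int (m i) - 2)"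
  have "(\<Sum>a\<in>pairs n. influence n e a) \<le> (\<Sum>a\<in>pairs n. \<Sum>i=1..s. \<bar>\<beta> i\<bar> * (?N i a / ?w i))"
    by (intro sum_mono) (auto simp: influence_def intro!: sum_nonneg mult_nonneg_nonneg divide_nonneg_nonneg)
  also have "\<dots> = (\<Sum>i=1..s. \<bar>\<beta> i\<bar> * ((\<Sum>a\<in>pairs n. ?N i a) / ?w i))"
    by (subst sum.swap) (simp add: sum_distrib_left sum_divide_distrib)
  also have "\<dots> \<le> C\<^sub>2"
    unfolding C\<^sub>2_def
  proof (intro sum_mono mult_left_mono)
    fix i assume i: "i \<in> {1..s}"
    have "(\<Sum>a\<in>pairs n. ?N i a) \<le> real (card (E i) * card (edge_embeddings (m i) (E i) n e))"
      using sum_two_edge_embeddings_le[OF simple[OF i] e] unfolding of_nat_sum[symmetric] of_nat_le_iff .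
    then have "(\<Sum>a\<in>pairs n. ?N i a) / ?w i
        \<le> real (card (E i)) * (real (card (edge_embeddings (m i) (E i) n e)) / ?w i)"
      by (simp add: divide_right_mono)
    also have "\<dots> \<le> real (card (E i)) * (2 * real (card (E i)))"
      using edge_embeddings_density_bounds(1)[OF simple[OF i] e n(2)[OF i] n(1)]
      by (intro mult_left_mono) auto
    finally show "(\<Sum>a\<in>pairs n. ?N i a) / ?w i \<le> real (card (E i)) * (2 * real (card (E i)))" .
  qed auto
  finally show ?thesis .
qed

lemma supermodular_hamiltonian:
  assumes n: "0 < n" "\<And>i. i \<in> {1..s} \<Longrightarrow> m i \<le> n"
  shows "supermodular_energy (pairs n) (hamiltonian s m E \<beta> n) (influence n) (C\<^sub>1 / real n) (C\<^sub>1 * C\<^sub>2 / real n)"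
proof
  fix e X Y assume *: "e \<in> pairs n" "X \<subseteq> Y" "Y \<subseteq> pairs n"
  show "discrete_deriv (hamiltonian s m E \<beta> n) e X \<le> discrete_deriv (hamiltonian s m E \<beta> n) e Y"
    unfolding discrete_deriv_hamiltonian
  proof (rule sum_mono)
    fix i assume i: "i \<in> {1..s}"
    show "\<beta> i * real (card (edge_copies (m i) (E i) n e X)) / real n powi (int (m i) - 2)
        \<le> \<beta> i * real (card (edge_copies (m i) (E i) n e Y)) / real n powi (int (m i) - 2)"
    proof (cases "i = 1")
      case True
      then show ?thesis by (simp only: E1 edge_copies_single)
    next
      case False
      then have "0 < \<beta> i" using i \<beta>_pos by auto
      then show ?thesis using *(2)
        by (intro divide_right_mono mult_left_mono) (auto intro!: card_mono edge_copies_mono)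
    qed
  qed
next
  fix e a X assume *: "e \<in> pairs n" "a \<in> pairs n" "X \<subseteq> pairs n" "a \<notin> X"
  show "\<bar>discrete_deriv (hamiltonian s m E \<beta> n) e (insert a X) - discrete_deriv (hamiltonian s m E \<beta> n) e X\<bar> \<le> influence n e a"
  proof (cases "a = e")
    case True
    then show ?thesis by (simp add: discrete_deriv_hamiltonian edge_copies_insert_self influence_def)
  next
    case False
    let ?c = "\<lambda>i X. real (card (edge_copies (m i) (E i) n e X))"
    let ?N = "\<lambda>i. real (card (edge_embeddings (m i) (E i) n e \<inter> edge_embeddings (m i) (E i) n a))"
    have d: "\<bar>?c i (insert a X) - ?c i X\<bar> \<le> ?N i" for i
    proof -
      have "card (edge_copies (m i) (E i) n e (insert a X))
          \<le> card (edge_copies (m i) (E i) n e X \<union> edge_embeddings (m i) (E i) n e \<inter> edge_embeddings (m i) (E i) n a)"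
        by (intro card_mono edge_copies_insert) auto
      also have "\<dots> \<le> card (edge_copies (m i) (E i) n e X) + card (edge_embeddings (m i) (E i) n e \<inter> edge_embeddings (m i) (E i) n a)"
        by (rule card_Un_le)
      moreover have "card (edge_copies (m i) (E i) n e X) \<le> card (edge_copies (m i) (E i) n e (insert a X))"
        by (intro card_mono edge_copies_mono) auto
      ultimately show ?thesis by linarith
    qed
    have eq: "discrete_deriv (hamiltonian s m E \<beta> n) e (insert a X) - discrete_deriv (hamiltonian s m E \<beta> n) e X
        = (\<Sum>i=1..s. \<beta> i * ((?c i (insert a X) - ?c i X) / real n powi (int (m i) - 2)))"
      by (simp add: discrete_deriv_hamiltonian sum_subtractf[symmetric] right_diff_distrib diff_divide_distrib)
    have "\<bar>discrete_deriv (hamiltonian s m E \<beta> n) e (insert a X) - discrete_deriv (hamiltonian s m E \<beta> n) e X\<bar>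
        \<le> (\<Sum>i=1..s. \<bar>\<beta> i * ((?c i (insert a X) - ?c i X) / real n powi (int (m i) - 2))\<bar>)"
      unfolding eq by (rule sum_abs)
    also have "\<dots> \<le> (\<Sum>i=1..s. \<bar>\<beta> i\<bar> * (?N i / real n powi (int (m i) - 2)))"
    proof (rule sum_mono)
      fix i
      have "\<bar>\<beta> i * ((?c i (insert a X) - ?c i X) / real n powi (int (m i) - 2))\<bar>
          = \<bar>\<beta> i\<bar> * (\<bar>?c i (insert a X) - ?c i X\<bar> / real n powi (int (m i) - 2))"
        by (simp add: abs_mult)
      also have "\<dots> \<le> \<bar>\<beta> i\<bar> * (?N i / real n powi (int (m i) - 2))"
        by (rule mult_left_mono[OF divide_right_mono[OF d]]) simp_all
      finally show "\<bar>\<beta> i * ((?c i (insert a X) - ?c i X) / real n powi (int (m i) - 2))\<bar>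
          \<le> \<bar>\<beta> i\<bar> * (?N i / real n powi (int (m i) - 2))" .
    qed
    finally show ?thesis using False by (simp add: influence_def)
  qed
next
  fix e assume e: "e \<in> pairs n"
  \<comment> \<open>The sum of squares is at most the largest influence times their sum, hence of
    order \<open>1/n\<close>.\<close>
  have "(\<Sum>a\<in>pairs n. (influence n e a)\<^sup>2) \<le> (\<Sum>a\<in>pairs n. C\<^sub>1 / real n * influence n e a)"
    unfolding power2_eq_square using e n influence_le influence_nonneg
    by (intro sum_mono mult_right_mono) auto
  also have "\<dots> \<le> C\<^sub>1 / real n * C\<^sub>2"
    unfolding sum_distrib_left[symmetric] using sum_influence_le[OF n e] C_nonneg
    by (intro mult_left_mono) auto
  finally show "(\<Sum>a\<in>pairs n. (influence n e a)\<^sup>2) \<le> C\<^sub>1 * C\<^sub>2 / real n" by simp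
qed (use n influence_le in auto)

definition mean_error :: "nat \<Rightarrow> real" where
  "mean_error n = (\<Sum>i=1..s. \<bar>\<beta> i\<bar> * (2 * real (card (E i)) * (1 - (1 - real (m i) / real n) ^ (m i - 2))))"

lemma mean_error_tendsto: "mean_error \<longlonglongrightarrow> 0"
proof -
  have "(\<lambda>n. \<Sum>i=1..s. \<bar>\<beta> i\<bar> * (2 * real (card (E i)) * (1 - (1 - real (m i) / real n) ^ (m i - 2))))
      \<longlonglongrightarrow> (\<Sum>i=1..s. \<bar>\<beta> i\<bar> * (2 * real (card (E i)) * (1 - (1 - 0) ^ (m i - 2))))"
    by (intro tendsto_intros lim_const_over_n)
  then show ?thesis by (simp add: mean_error_def[abs_def])
qed

text \<open>The mean is \<open>Psi\<close> with each \<open>2 * card (E i)\<close> replaced by the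
  normalised number of embeddings through \<open>e\<close>; \<open>mean_error\<close> collects the
  discrepancies, uniformly in \<open>e\<close> and \<open>\<rho>\<close>.\<close>

lemma mean_discrete_deriv:
  assumes n: "0 < n" "\<And>i. i \<in> {1..s} \<Longrightarrow> m i \<le> n" and e: "e \<in> pairs n" and \<rho>: "0 \<le> \<rho>" "\<rho> \<le> 1"
  shows "\<bar>bernoulli_mean \<rho> (pairs n) (discrete_deriv (hamiltonian s m E \<beta> n) e) - Psi s E \<beta> \<rho>\<bar> \<le> mean_error n"
proof -
  let ?w = "\<lambda>i. real n powi (int (m i) - 2)"
  let ?r = "\<lambda>i. real (card (edge_embeddings (m i) (E i) n e)) / ?w i"
  have "bernoulli_mean \<rho> (pairs n) (discrete_deriv (hamiltonian s m E \<beta> n) e)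
      = bernoulli_mean \<rho> (pairs n) (\<lambda>X. \<Sum>i=1..s. \<beta> i / ?w i * real (card (edge_copies (m i) (E i) n e X)))"
    by (simp add: discrete_deriv_hamiltonian[abs_def])
  also have "\<dots> = (\<Sum>i=1..s. \<beta> i / ?w i * (real (card (edge_embeddings (m i) (E i) n e)) * \<rho> ^ (card (E i) - 1)))"
    unfolding bernoulli_mean_sum bernoulli_mean_cmult using simple
    by (intro sum.cong refl) (simp add: bernoulli_mean_edge_copies)
  finally have eq: "bernoulli_mean \<rho> (pairs n) (discrete_deriv (hamiltonian s m E \<beta> n) e) - Psi s E \<beta> \<rho>
      = (\<Sum>i=1..s. \<beta> i * ((?r i - 2 * real (card (E i))) * \<rho> ^ (card (E i) - 1)))"
    by (simp only: Psi_eq sum_subtractf[symmetric]) (intro sum.cong refl, simp add: algebra_simps)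
  have "\<bar>bernoulli_mean \<rho> (pairs n) (discrete_deriv (hamiltonian s m E \<beta> n) e) - Psi s E \<beta> \<rho>\<bar>
      \<le> (\<Sum>i=1..s. \<bar>\<beta> i * ((?r i - 2 * real (card (E i))) * \<rho> ^ (card (E i) - 1))\<bar>)"
    unfolding eq by (rule sum_abs)
  also have "\<dots> \<le> mean_error n"
    unfolding mean_error_def abs_mult
  proof (intro sum_mono mult_left_mono)
    fix i assume i: "i \<in> {1..s}"
    have "\<bar>?r i - 2 * real (card (E i))\<bar> \<le> 2 * real (card (E i)) * (1 - (1 - real (m i) / real n) ^ (m i - 2))"
      using edge_embeddings_density_bounds[OF simple[OF i] e n(2)[OF i] n(1)] by (simp add: algebra_simps)
    moreover have "\<bar>\<rho> ^ (card (E i) - 1)\<bar> \<le> 1" using \<rho> by (simp add: power_le_one)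
    ultimately show "\<bar>?r i - 2 * real (card (E i))\<bar> * \<bar>\<rho> ^ (card (E i) - 1)\<bar>
        \<le> 2 * real (card (E i)) * (1 - (1 - real (m i) / real n) ^ (m i - 2))"
      by (meson abs_ge_zero mult_left_le order_trans)
  qed auto
  finally show ?thesis .
qed

section \<open>Choice of constants and the exponential lower bound\<close>

theorem mixing_time_exponential:
  fixes f :: "nat \<Rightarrow> real"
  assumes low: "low_temperature s E \<beta>" and f: "f \<in> o(\<lambda>n. real n)"
  shows "\<exists>a>0. \<forall>\<^sub>F n in sequentially. \<forall>K.
    markov_kernel (graphs n) K \<and> stationary (graphs n) K (gibbs s m E \<beta> n) \<and> local_chain (graphs n) K (f n) \<longrightarrow>
    ereal (exp (a * real n)) \<le> ereal_of_enat (mixing_time (graphs n) K (gibbs s m E \<beta> n))"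
proof -
  let ?\<Psi> = "Psi s E \<beta>" and ?\<phi> = "phi s E \<beta>"
  obtain u v where uv: "0 < u" "u < v" "?\<phi> u < u" "v < ?\<phi> v"
    using low_temperature_wells[OF low] by blast
  \<comment> \<open>Equal values would give \<open>?\<phi> u = ?\<phi> v\<close>, contrary to
    \<open>?\<phi> u < u < v < ?\<phi> v\<close>. Thus \<open>Psi\<close> is not constant, as strict
    monotonicity requires.\<close>
  have "?\<Psi> u \<noteq> ?\<Psi> v" using uv by (auto simp: phi_def)
  note strict = Psi_strict_mono[OF this]
  have \<theta>: "?\<Psi> u < ?\<Psi> v" using uv by (intro strict) auto
  have \<theta>1: "?\<Psi> (?\<phi> u) < ?\<Psi> u" using uv phi_bounds[of s E \<beta> u] by (intro strict) auto
  have \<theta>2: "?\<Psi> v < ?\<Psi> (?\<phi> v)" using uv by (intro strict) auto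
  \<comment> \<open>A third of the smaller gap: two thirds give the margin
    \<open>2 * \<delta>\<close> demanded of the means, the rest absorbs
    \<open>mean_error n\<close>.\<close>
  define \<delta> where "\<delta> = min (?\<Psi> u - ?\<Psi> (?\<phi> u)) (?\<Psi> (?\<phi> v) - ?\<Psi> v) / 3"
  have \<delta>: "0 < \<delta>" "?\<Psi> (?\<phi> u) + 3 * \<delta> \<le> ?\<Psi> u" "?\<Psi> v + 3 * \<delta> \<le> ?\<Psi> (?\<phi> v)"
    using \<theta>1 \<theta>2 by (auto simp: \<delta>_def min_def)
  \<comment> \<open>The Chernoff parameter is \<open>t * real n\<close>. The first bound on
    \<open>t\<close> keeps its product with every influence at most 1, the second makes the
    fluctuation term at most half of the gain; adding 1 avoids division by zero.\<close>
  define t where "t = min (1 / (C\<^sub>1 + 1)) (\<delta> / (2 * (C\<^sub>1 * C\<^sub>2 + 1)))"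
  have C12: "0 \<le> C\<^sub>1 * C\<^sub>2" using C_nonneg by simp
  have t0: "0 < t" using C_nonneg(1) C12 \<delta>(1) by (simp add: t_def)
  have t1: "t * C\<^sub>1 \<le> 1"
  proof -
    have "t * C\<^sub>1 \<le> 1 / (C\<^sub>1 + 1) * C\<^sub>1" using C_nonneg by (intro mult_right_mono) (auto simp: t_def)
    also have "\<dots> \<le> 1" using C_nonneg(1) by (simp add: field_simps)
    finally show ?thesis .
  qed
  have t2: "t * (C\<^sub>1 * C\<^sub>2) \<le> \<delta> / 2"
  proof -
    have "t * (C\<^sub>1 * C\<^sub>2) \<le> \<delta> / (2 * (C\<^sub>1 * C\<^sub>2 + 1)) * (C\<^sub>1 * C\<^sub>2)" using C12 by (intro mult_right_mono) (auto simp: t_def)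
    also have "\<dots> \<le> \<delta> / 2" using C12 \<delta>(1) by (simp add: field_simps)
    finally show ?thesis .
  qed
  \<comment> \<open>The boundary estimate decays like \<open>exp (- 2 * a * n)\<close>. Half of this
    rate pays for \<open>M = exp (a * n)\<close>, the other half beats the number of pairs.\<close>
  define a where "a = t * \<delta> / 4"
  have a: "0 < a" using t0 \<delta>(1) by (simp add: a_def)
  \<comment> \<open>With this bound \<open>f n\<close> flips change a derivative by at most
    \<open>\<delta> / 2\<close>.\<close>
  have "\<forall>\<^sub>F n in sequentially. norm (f n) \<le> \<delta> / (2 * (C\<^sub>1 + 1)) * norm (real n)"
    using C_nonneg(1) \<delta>(1) by (intro landau_o.smallD[OF f]) simp
  moreover have "\<forall>\<^sub>F n in sequentially. mean_error n < \<delta>"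
    using order_tendstoD(2)[OF mean_error_tendsto \<delta>(1)] .
  moreover have "\<forall>\<^sub>F n in sequentially. (real n)\<^sup>2 * exp (- (a * real n)) \<le> 1/10"
  proof -
    have lim: "filterlim (\<lambda>n. a * real n) at_top sequentially"
      using a by (intro filterlim_tendsto_pos_mult_at_top[OF tendsto_const]) (auto intro: filterlim_real_sequentially)
    have "((\<lambda>x::real. x ^ 2 / exp x) \<longlongrightarrow> 0) at_top" by (rule tendsto_power_div_exp_0)
    from filterlim_compose[OF this lim] have "(\<lambda>n. (a * real n)\<^sup>2 / exp (a * real n)) \<longlonglongrightarrow> 0" .
    moreover have "0 < a\<^sup>2 / 10" using a by simp
    ultimately have "\<forall>\<^sub>F n in sequentially. (a * real n)\<^sup>2 / exp (a * real n) < a\<^sup>2 / 10"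
      by (rule order_tendstoD(2))
    then show ?thesis
    proof eventually_elim
      case (elim n)
      have "a\<^sup>2 * ((real n)\<^sup>2 * exp (- (a * real n))) = (a * real n)\<^sup>2 / exp (a * real n)"
        by (simp add: exp_minus power_mult_distrib field_simps)
      with elim have "a\<^sup>2 * ((real n)\<^sup>2 * exp (- (a * real n))) < a\<^sup>2 * (1 / 10)" by simp
      then show ?case using a by simp
    qed
  qed
  moreover have "\<forall>\<^sub>F n in sequentially. \<forall>i\<in>{1..s}. m i \<le> n"
    by (intro eventually_ball_finite ballI eventually_ge_at_top) simp
  moreover have "\<forall>\<^sub>F n in sequentially. 2 \<le> n" by (rule eventually_ge_at_top)
  ultimately have "\<forall>\<^sub>F n in sequentially. \<forall>K.
    markov_kernel (graphs n) K \<and> stationary (graphs n) K (gibbs s m E \<beta> n) \<and> local_chain (graphs n) K (f n) \<longrightarrow>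
    ereal (exp (a * real n)) \<le> ereal_of_enat (mixing_time (graphs n) K (gibbs s m E \<beta> n))"
  proof eventually_elim
    case (elim n)
    have n: "0 < n" "\<And>i. i \<in> {1..s} \<Longrightarrow> m i \<le> n" using elim by auto
    interpret supermodular_energy "pairs n" "hamiltonian s m E \<beta> n" "influence n" "C\<^sub>1 / real n" "C\<^sub>1 * C\<^sub>2 / real n"
      using n by (rule supermodular_hamiltonian)
    have gibbs: "gibbs s m E \<beta> n = (\<lambda>X. exp (hamiltonian s m E \<beta> n X) / (\<Sum>Y\<in>Pow (pairs n). exp (hamiltonian s m E \<beta> n Y)))"
      by (simp add: gibbs_def[abs_def] graphs_def)
    show ?case
      unfolding gibbs graphs_def
    proof (intro allI impI, elim conjE)
      fix K
      assume K: "markov_kernel (Pow (pairs n)) K" "local_chain (Pow (pairs n)) K (f n)"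
        "stationary (Pow (pairs n)) K (\<lambda>X. exp (hamiltonian s m E \<beta> n X) / (\<Sum>Y\<in>Pow (pairs n). exp (hamiltonian s m E \<beta> n Y)))"
      show "ereal (exp (a * real n)) \<le> ereal_of_enat (mixing_time (Pow (pairs n)) K
        (\<lambda>X. exp (hamiltonian s m E \<beta> n X) / (\<Sum>Y\<in>Pow (pairs n). exp (hamiltonian s m E \<beta> n Y))))"
      proof (rule mixing_time_ge_two_wells[OF K(1,3), where k = "f n" and \<delta> = \<delta>
            and \<theta>\<^sub>1 = "?\<Psi> u" and \<theta>\<^sub>2 = "?\<Psi> v" and \<rho>\<^sub>1 = "?\<phi> u" and \<rho>\<^sub>2 = "?\<phi> v" and \<tau> = "t * real n"])
        show "real (card (X - Y \<union> (Y - X))) \<le> f n"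
          if "X \<in> Pow (pairs n)" "Y \<in> Pow (pairs n)" "K X Y > 0" for X Y
          using K(2) that by (auto simp: local_chain_def)
        have "card (pairs n) > 0" using elim by (simp add: card_pairs)
        then show "pairs n \<noteq> {}" by auto
        show "0 \<le> C\<^sub>1 / real n" using C_nonneg by simp
        have "C\<^sub>1 / real n * f n \<le> C\<^sub>1 / real n * (\<delta> / (2 * (C\<^sub>1 + 1)) * real n)"
          using elim C_nonneg by (intro mult_left_mono) auto
        also have "\<dots> = \<delta> / 2 * (C\<^sub>1 / (C\<^sub>1 + 1))" using n by simp
        also have "\<dots> \<le> \<delta> / 2 * 1" using \<delta>(1) C_nonneg by (intro mult_left_mono) auto
        finally have "C\<^sub>1 / real n * f n \<le> \<delta> / 2" by (simp only: mult_1_right)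
        then show "C\<^sub>1 / real n * f n < \<delta>" using \<delta>(1) by linarith
        show "0 \<le> \<delta>" using \<delta> by simp
        show "?\<Psi> u < ?\<Psi> v" by (rule \<theta>)
        show "?\<phi> u = exp (?\<Psi> u) / (1 + exp (?\<Psi> u))" "?\<phi> v = exp (?\<Psi> v) / (1 + exp (?\<Psi> v))"
          by (simp_all add: phi_def)
        fix e assume e: "e \<in> pairs n"
        have \<rho>: "0 \<le> ?\<phi> x" "?\<phi> x \<le> 1" for x using phi_bounds[of s E \<beta> x] by auto
        show "bernoulli_mean (?\<phi> u) (pairs n) (discrete_deriv (hamiltonian s m E \<beta> n) e) \<le> ?\<Psi> u - 2 * \<delta>"
          using mean_discrete_deriv[OF n e \<rho>[of u]] elim(2) \<delta>(2) by linarith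
        show "?\<Psi> v + 2 * \<delta> \<le> bernoulli_mean (?\<phi> v) (pairs n) (discrete_deriv (hamiltonian s m E \<beta> n) e)"
          using mean_discrete_deriv[OF n e \<rho>[of v]] elim(2) \<delta>(3) by linarith
      next
        show "0 \<le> t * real n" using t0 by simp
        show "t * real n * (C\<^sub>1 / real n) \<le> 1" using t1 n by simp
        have "(t * real n)\<^sup>2 * (C\<^sub>1 * C\<^sub>2 / real n) - t * real n * \<delta> = (t * real n) * (t * (C\<^sub>1 * C\<^sub>2) - \<delta>)"
          using n by (simp add: power2_eq_square field_simps)
        also have "\<dots> \<le> (t * real n) * (- (\<delta> / 2))" using t2 t0 by (intro mult_left_mono) auto
        also have "\<dots> = - (a * real n) - a * real n" by (simp add: a_def)
        finally have x: "(t * real n)\<^sup>2 * (C\<^sub>1 * C\<^sub>2 / real n) - t * real n * \<delta> \<le> - (a * real n) - a * real n" .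
        have "n choose 2 \<le> n\<^sup>2" using binomial_le_pow[of 2 n] elim by simp
        then have c: "real (card (pairs n)) \<le> (real n)\<^sup>2"
          unfolding card_pairs by (metis of_nat_le_iff of_nat_power)
        have "real (card (pairs n)) * exp ((t * real n)\<^sup>2 * (C\<^sub>1 * C\<^sub>2 / real n) - t * real n * \<delta>) * exp (a * real n)
            \<le> (real n)\<^sup>2 * exp (- (a * real n) - a * real n) * exp (a * real n)"
          using c x by (intro mult_right_mono mult_mono) auto
        also have "\<dots> = (real n)\<^sup>2 * exp (- (a * real n))" by (simp add: mult.assoc flip: exp_add)
        also have "\<dots> \<le> 1/10" by (rule elim(3))
        finally show "real (card (pairs n)) * exp ((t * real n)\<^sup>2 * (C\<^sub>1 * C\<^sub>2 / real n) - t * real n * \<delta>) * exp (a * real n) \<le> 1/10" .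
      qed
    qed
  qed
  with a show ?thesis by blast
qed

end

theorem theorem2:
  fixes s :: nat and m :: "nat \<Rightarrow> nat" and E :: "nat \<Rightarrow> nat set set" and \<beta> :: "nat \<Rightarrow> real"
  assumes "s \<ge> 1"
    and "m 1 = 2" and "E 1 = {{1, 2}}"
    and "\<forall>i\<in>{1..s}. simple_graph (m i) (E i)"
    and "\<forall>i\<in>{2..s}. \<beta> i > 0"
    and "low_temperature s E \<beta>"
  shows "(\<exists>a>0. \<forall>\<^sub>F n in sequentially.
            ereal (exp (a * real n)) \<le>
            ereal_of_enat (mixing_time (graphs n) (glauber s m E \<beta> n) (gibbs s m E \<beta> n)))
       \<and> (\<forall>f :: nat \<Rightarrow> real. f \<in> o(\<lambda>n. real n) \<longrightarrow>
            (\<exists>a>0. \<forall>\<^sub>F n in sequentially. \<forall>P.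
               markov_kernel (graphs n) P \<and> stationary (graphs n) P (gibbs s m E \<beta> n)
               \<and> local_chain (graphs n) P (f n) \<longrightarrow>
               ereal (exp (a * real n)) \<le>
               ereal_of_enat (mixing_time (graphs n) P (gibbs s m E \<beta> n))))"
proof -
  interpret ergm s m E \<beta>
    using assms by unfold_locales (auto simp: simple_graph_def)
  \<comment> \<open>Glauber dynamics changes at most one pair per step, so the constant function 1
    serves as the locality bound.\<close>
  have "(\<lambda>_. 1) \<in> o(\<lambda>n. real n)"
    by (rule smalloI_tendsto) (auto simp: lim_inverse_n' eventually_at_top_linorder intro: exI[of _ 1])
  from mixing_time_exponential[OF assms(6) this]
  obtain a where a: "a > 0" "\<forall>\<^sub>F n in sequentially. \<forall>K.
    markov_kernel (graphs n) K \<and> stationary (graphs n) K (gibbs s m E \<beta> n) \<and> local_chain (graphs n) K 1 \<longrightarrow>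
    ereal (exp (a * real n)) \<le> ereal_of_enat (mixing_time (graphs n) K (gibbs s m E \<beta> n))"
    by blast
  have "\<forall>\<^sub>F n in sequentially. ereal (exp (a * real n)) \<le>
      ereal_of_enat (mixing_time (graphs n) (glauber s m E \<beta> n) (gibbs s m E \<beta> n))"
    using a(2) eventually_ge_at_top[of 2]
  proof eventually_elim
    case (elim n)
    then show ?case
      using markov_kernel_glauber stationary_glauber local_chain_glauber by blast
  qed
  with a(1) mixing_time_exponential[OF assms(6)] show ?thesis by blast
qed

end
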